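(* Let $G$ be a stochastic context-free grammar with start symbol $S$ and terminal alphabet $\Sigma$ that is proper, consistent, has no useless nonterminals, and has no null productions. Let $x=x_0x_1\cdots x_{l-1}\in\Sigma^*$ be a nonempty input string of length $l\geq 1$, write $x_{k\ldots i-1}=x_k\cdots x_{i-1}$, and consider the Earley chart for $x$, with forward probabilities $\alpha_i$ and inner probabilities $\gamma_i$ relative to $x$. Then: (a) Let $0\le k<i\le l$ and let $X$ be a nonterminal such that there is a left-most derivation $S\stackrel{*}{\Rightarrow}x_{0\ldots k-1}X\nu$ in $G$ for some $\nu$. Then $$P(X\stackrel{*}{\Rightarrow}x_{k\ldots i-1})=\sum_{i:\,{}_kX\to\lambda.}\gamma_i({}_kX\to\lambda.),$$ the sum being over all complete states in the chart at position $i$ with left-hand side $X$ and start index $k$. (b) In particular, $P(S\stackrel{*}{\Rightarrow}x)=\gamma_l({}_0\to S.)=\alpha_l({}_0\to S.)$. (c) The prefix probability of $x$ is $$P(S\stackrel{*}{\Rightarrow}_L x)=\sum_{{}_kX\to\lambda x_{l-1}.\mu}\alpha_l({}_kX\to\lambda x_{l-1}.\mu),$$ the sum being over all scanned states in the chart at position $l$.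
   Context: Grammar. A stochastic context-free grammar (SCFG) $G$ is a context-free grammar (finite sets of nonterminals, terminals $\Sigma$, and productions; start symbol $S$) with a probability $P(X\to\lambda)\in[0,1]$ attached to each production $X\to\lambda$. No null productions: every right-hand side $\lambda$ is nonempty. $G$ is proper if for each nonterminal $X$ the probabilities of all productions with left-hand side $X$ sum to $1$; consistent if $\sum_{x\in\Sigma^*}P(S\stackrel{*}{\Rightarrow}x)=1$; has no useless nonterminals if every nonterminal $X$ appears in some derivation of nonzero probability of some terminal string, $S\stackrel{*}{\Rightarrow}\lambda X\mu\stackrel{*}{\Rightarrow}x\in\Sigma^*$. String and prefix probabilities. The probability of a derivation is the product of the probabilities of the productions applied in its steps. $P(X\stackrel{*}{\Rightarrow}x)$ is the sum of the probabilities of all left-most derivations of $x$ from $X$, and $P(S\stackrel{*}{\Rightarrow}_L x)=\sum_{y\in\Sigma^*}P(S\stackrel{*}{\Rightarrow}xy)$. Earley states and chart. A state is written $i:\ {}_kX\to\lambda.\mu$, with $0\le k\le i$ integers and $X\to\lambda\mu$ a production; additionally there are dummy states with empty left-hand side, coming from a dummy production $\to S$: the initial state $0:{}_0\to.S$ and states $i:{}_0\to S.$. A state is complete if nothing is to the right of the dot. A predicted state is one of the form $i:{}_iY\to.\nu$ with $Y\to\nu$ a production of $G$. A scanned state is one with a terminal immediately to the left of the dot. The Earley chart for $x$ is the smallest set of states containing the initial state and closed under: prediction (from $i:{}_kX\to\lambda.Y\mu$, $Y$ a nonterminal, add $i:{}_iY\to.\nu$ for every production $Y\to\nu$); scanning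 (from $i:{}_kX\to\lambda.a\mu$ with $i<l$ and terminal $a=x_i$, add $i+1:{}_kX\to\lambda a.\mu$); completion (from $i:{}_jY\to\nu.$ and $j:{}_kX\to\lambda.Y\mu$ with $j<i$, add $i:{}_kX\to\lambda Y.\mu$). Here $X$ may be empty for dummy states. Paths. A path is a finite sequence of states $s_1,\dots,s_m$ ($m\ge1$), where $s_1$ is the initial state or a predicted state, together with a root index $\rho(t)$ for each $t$, with $\rho(1)=1$, such that each $s_{t+1}$ arises by one of: - Prediction: $s_t=(i:{}_kX\to\lambda.Y\mu)$, $s_{t+1}=(i:{}_iY\to.\nu)$ for some production $Y\to\nu$; $\rho(t+1)=t+1$. - Scanning (of an arbitrary terminal $a$): $s_t=(i:{}_kX\to\lambda.a\mu)$, $s_{t+1}=(i+1:{}_kX\to\lambda a.\mu)$; $\rho(t+1)=\rho(t)$. - Completion: $s_t=(i:{}_jY\to\nu.)$ is complete, $\rho(t)>1$, and $s_{\rho(t)-1}=(j:{}_kX\to\lambda.Y\mu)$ is the state from which that expansion of $Y$ was predicted; $s_{t+1}=(i:{}_kX\to\lambda Y.\mu)$; $\rho(t+1)=\rho(\rho(t)-1)$. The length of a path is its number of scanning steps; it generates the string of terminals scanned, in order. Its probability is the product of $P(Y\to\nu)$ over all occurrences of predicted states ${}_iY\to.\nu$ on it, including the first state if it is predicted (the dummy production contributes factor $1$). Forward and inner probabilities (relative to $x$). The forward probability $\alpha_i({}_kX\to\lambda.\mu)$ is the sum of the probabilities of all paths of length $i$ that start with the initial state, generate $x_{0\ldots i-1}$,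 and end in the state $i:{}_kX\to\lambda.\mu$. The inner probability $\gamma_i({}_kX\to\lambda.\mu)$ is the sum of the probabilities of all paths $s_1,\dots,s_m$ of length $i-k$ that start in $s_1=(k:{}_kX\to.\lambda\mu)$, end in $s_m=(i:{}_kX\to\lambda.\mu)$ with $\rho(m)=1$ (the last state is the first state with its dot moved), and generate $x_{k\ldots i-1}$. The same definitions apply to dummy states. Empty sums are $0$. *)

theory Defs
  imports "HOL-Analysis.Analysis"
begin

text \<open>
  Sums of probabilities over infinite families (derivations, strings, paths) are taken in
  \<^typ>\<open>ennreal\<close>, where they always exist.
\<close>

datatype ('n, 't) sym = NT 'n | T 't

type_synonym ('n, 't) production = "'n \<times> ('n, 't) sym list"

record ('n, 't) scfg =
  nonterms :: "'n set"
  terminals :: "'t set"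
  prods :: "('n, 't) production set"
  start :: 'n
  prod_prob :: "('n, 't) production \<Rightarrow> real"

definition is_scfg :: "('n, 't) scfg \<Rightarrow> bool" where
  "is_scfg G \<longleftrightarrow>
     finite (nonterms G) \<and> finite (terminals G) \<and> finite (prods G) \<and>
     start G \<in> nonterms G \<and>
     prods G \<subseteq> nonterms G \<times> lists (NT ` nonterms G \<union> T ` terminals G) \<and>
     (\<forall>r\<in>prods G. 0 \<le> prod_prob G r \<and> prod_prob G r \<le> 1)"

definition no_null_productions :: "('n, 't) scfg \<Rightarrow> bool" where
  "no_null_productions G \<longleftrightarrow> (\<forall>(X, \<nu>)\<in>prods G. \<nu> \<noteq> [])"

definition proper :: "('n, 't) scfg \<Rightarrow> bool" where
  "proper G \<longleftrightarrow> (\<forall>X\<in>nonterms G. (\<Sum>\<nu> | (X, \<nu>) \<in> prods G. prod_prob G (X, \<nu>)) = 1)"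


section \<open>Derivations\<close>

text \<open>
  A derivation is represented by the list of productions applied in its steps. For left-most
  derivations from a given sentential form this list determines the whole derivation and
  vice versa, so summing over such lists is summing over left-most derivations.
\<close>

inductive derivation ::
  "('n, 't) scfg \<Rightarrow> ('n, 't) sym list \<Rightarrow> ('n, 't) production list \<Rightarrow> ('n, 't) sym list \<Rightarrow> bool"
  for G where
  refl: "derivation G \<phi> [] \<phi>"
| step: "(Y, \<nu>) \<in> prods G \<Longrightarrow> derivation G (\<xi> @ \<nu> @ \<mu>) rs \<psi> \<Longrightarrow>
    derivation G (\<xi> @ NT Y # \<mu>) ((Y, \<nu>) # rs) \<psi>"

inductive leftmost_derivation ::
  "('n, 't) scfg \<Rightarrow> ('n, 't) sym list \<Rightarrow> ('n, 't) production list \<Rightarrow> ('n, 't) sym list \<Rightarrow> bool"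
  for G where
  refl: "leftmost_derivation G \<phi> [] \<phi>"
| step: "(Y, \<nu>) \<in> prods G \<Longrightarrow> leftmost_derivation G (map T u @ \<nu> @ \<mu>) rs \<psi> \<Longrightarrow>
    leftmost_derivation G (map T u @ NT Y # \<mu>) ((Y, \<nu>) # rs) \<psi>"

definition derivation_prob :: "('n, 't) scfg \<Rightarrow> ('n, 't) production list \<Rightarrow> real" where
  "derivation_prob G rs = prod_list (map (prod_prob G) rs)"

definition string_prob :: "('n, 't) scfg \<Rightarrow> 'n \<Rightarrow> 't list \<Rightarrow> ennreal" where
  "string_prob G X x =
     (\<Sum>\<^sub>\<infinity>rs\<in>{rs. leftmost_derivation G [NT X] rs (map T x)}. ennreal (derivation_prob G rs))"

definition prefix_prob :: "('n, 't) scfg \<Rightarrow> 't list \<Rightarrow> ennreal" where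
  "prefix_prob G x = (\<Sum>\<^sub>\<infinity>y\<in>lists (terminals G). string_prob G (start G) (x @ y))"

definition consistent :: "('n, 't) scfg \<Rightarrow> bool" where
  "consistent G \<longleftrightarrow> (\<Sum>\<^sub>\<infinity>x\<in>lists (terminals G). string_prob G (start G) x) = 1"

definition no_useless_nonterminals :: "('n, 't) scfg \<Rightarrow> bool" where
  "no_useless_nonterminals G \<longleftrightarrow>
     (\<forall>X\<in>nonterms G. \<exists>\<xi> \<mu> x rs rs'.
        x \<in> lists (terminals G) \<and>
        derivation G [NT (start G)] rs (\<xi> @ NT X # \<mu>) \<and>
        derivation G (\<xi> @ NT X # \<mu>) rs' (map T x) \<and>
        derivation_prob G (rs @ rs') \<noteq> 0)"


section \<open>Earley states and chart\<close>

text \<open>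
  \<open>State i k X \<xi> \<mu>\<close> stands for the state at position \<open>i\<close> with start index \<open>k\<close>, left-hand side
  \<open>X\<close>, and \<open>\<xi>\<close>, \<open>\<mu>\<close> the parts of the right-hand side before and after the dot. The left-hand
  side is \<open>None\<close> for the dummy states.
\<close>

datatype ('n, 't) state =
  State (pos: nat) (origin: nat) (lhs: "'n option")
        (before: "('n, 't) sym list") (after: "('n, 't) sym list")

definition initial_state :: "('n, 't) scfg \<Rightarrow> ('n, 't) state" where
  "initial_state G = State 0 0 None [] [NT (start G)]"

definition final_state :: "('n, 't) scfg \<Rightarrow> nat \<Rightarrow> ('n, 't) state" where
  "final_state G i = State i 0 None [NT (start G)] []"

definition complete_state :: "('n, 't) state \<Rightarrow> bool" where
  "complete_state s \<longleftrightarrow> after s = []"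

definition predicted_state :: "('n, 't) scfg \<Rightarrow> ('n, 't) state \<Rightarrow> bool" where
  "predicted_state G s \<longleftrightarrow> (\<exists>i Y \<nu>. (Y, \<nu>) \<in> prods G \<and> s = State i i (Some Y) [] \<nu>)"

definition scanned_state :: "('n, 't) state \<Rightarrow> bool" where
  "scanned_state s \<longleftrightarrow> (\<exists>\<xi> a. before s = \<xi> @ [T a])"

inductive_set chart :: "('n, 't) scfg \<Rightarrow> 't list \<Rightarrow> ('n, 't) state set"
  for G x where
  init: "initial_state G \<in> chart G x"
| prediction: "State i k X \<xi> (NT Y # \<mu>) \<in> chart G x \<Longrightarrow> (Y, \<nu>) \<in> prods G \<Longrightarrow>
    State i i (Some Y) [] \<nu> \<in> chart G x"
| scanning: "State i k X \<xi> (T a # \<mu>) \<in> chart G x \<Longrightarrow> i < length x \<Longrightarrow> a = x ! i \<Longrightarrow>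
    State (i + 1) k X (\<xi> @ [T a]) \<mu> \<in> chart G x"
| completion: "State i j (Some Y) \<nu> [] \<in> chart G x \<Longrightarrow> State j k X \<xi> (NT Y # \<mu>) \<in> chart G x \<Longrightarrow>
    j < i \<Longrightarrow> State i k X (\<xi> @ [NT Y]) \<mu> \<in> chart G x"


section \<open>Paths\<close>

text \<open>
  A path is a nonempty list of states paired with their root indices. List positions, and hence
  root indices, are counted from 0 here: the first state has root index 0, and a state with root
  index \<open>r > 0\<close> belongs to an expansion predicted from the state at list position \<open>r - 1\<close>.
\<close>

inductive path :: "('n, 't) scfg \<Rightarrow> (('n, 't) state \<times> nat) list \<Rightarrow> bool"
  for G where
  init: "s = initial_state G \<or> predicted_state G s \<Longrightarrow> path G [(s, 0)]"
| prediction: "path G p \<Longrightarrow> last p = (State i k X \<xi> (NT Y # \<mu>), r) \<Longrightarrow> (Y, \<nu>) \<in> prods G \<Longrightarrow>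
    path G (p @ [(State i i (Some Y) [] \<nu>, length p)])"
| scanning: "path G p \<Longrightarrow> last p = (State i k X \<xi> (T a # \<mu>), r) \<Longrightarrow>
    path G (p @ [(State (i + 1) k X (\<xi> @ [T a]) \<mu>, r)])"
| completion: "path G p \<Longrightarrow> last p = (State i j (Some Y) \<nu> [], r) \<Longrightarrow> r > 0 \<Longrightarrow>
    p ! (r - 1) = (State j k X \<xi> (NT Y # \<mu>), r') \<Longrightarrow>
    path G (p @ [(State i k X (\<xi> @ [NT Y]) \<mu>, r')])"

text \<open>
  The first state of a path has its dot in front, so the scanning steps of a path are exactly the
  steps leading to its scanned states, and the terminal scanned is the one left of the dot.
\<close>

definition path_length :: "(('n, 't) state \<times> nat) list \<Rightarrow> nat" where
  "path_length p = length (filter (\<lambda>(s, r). scanned_state s) p)"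

definition generated_string :: "(('n, 't) state \<times> nat) list \<Rightarrow> 't list" where
  "generated_string p =
     map (\<lambda>(s, r). THE a. last (before s) = T a) (filter (\<lambda>(s, r). scanned_state s) p)"

definition path_prob :: "('n, 't) scfg \<Rightarrow> (('n, 't) state \<times> nat) list \<Rightarrow> real" where
  "path_prob G p =
     prod_list (map (\<lambda>(s, r). prod_prob G (the (lhs s), after s))
       (filter (\<lambda>(s, r). predicted_state G s) p))"


section \<open>Forward and inner probabilities\<close>

text \<open>\<open>substring x k i\<close> is $x_k \cdots x_{i-1}$.\<close>

definition substring :: "'a list \<Rightarrow> nat \<Rightarrow> nat \<Rightarrow> 'a list" where
  "substring x k i = take (i - k) (drop k x)"

definition forward_paths ::
  "('n, 't) scfg \<Rightarrow> 't list \<Rightarrow> ('n, 't) state \<Rightarrow> (('n, 't) state \<times> nat) list set" where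
  "forward_paths G x s =
     {p. path G p \<and> fst (hd p) = initial_state G \<and> fst (last p) = s \<and>
         path_length p = pos s \<and> generated_string p = substring x 0 (pos s)}"

definition forward_prob :: "('n, 't) scfg \<Rightarrow> 't list \<Rightarrow> ('n, 't) state \<Rightarrow> ennreal" where
  "forward_prob G x s = (\<Sum>\<^sub>\<infinity>p\<in>forward_paths G x s. ennreal (path_prob G p))"

definition inner_paths ::
  "('n, 't) scfg \<Rightarrow> 't list \<Rightarrow> ('n, 't) state \<Rightarrow> (('n, 't) state \<times> nat) list set" where
  "inner_paths G x s =
     {p. path G p \<and>
         fst (hd p) = State (origin s) (origin s) (lhs s) [] (before s @ after s) \<and>
         last p = (s, 0) \<and>
         path_length p = pos s - origin s \<and>
         generated_string p = substring x (origin s) (pos s)}"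

definition inner_prob :: "('n, 't) scfg \<Rightarrow> 't list \<Rightarrow> ('n, 't) state \<Rightarrow> ennreal" where
  "inner_prob G x s = (\<Sum>\<^sub>\<infinity>p\<in>inner_paths G x s. ennreal (path_prob G p))"

end

theory Submission
  imports Defs "HOL-Library.Sublist"
begin

text \<open>
  An Earley path is a leftmost parser run. Its stack of waiting states, together with the string
  scanned so far, encodes a sentential form; prediction applies a production to the leftmost
  nonterminal of this form, while scanning and completion do not change it. As paths can branch
  only at predictions, a path is determined by the list of its predicted productions, which is a
  leftmost derivation of the encoded form. Hence complete paths correspond to leftmost derivations
  of terminal strings, with equal probabilities, which gives (a) and (b). For (c), a derivation of
  a string with prefix \<open>x\<close> is cut where the last letter of \<open>x\<close> is scanned. The second part
  is an arbitrary terminating derivation of the remaining sentential form, and the probabilities of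
  these sum to 1: the start symbol terminates with probability 1 by consistency, for a proper
  grammar this passes to every symbol reachable with positive probability, and no nonterminal is
  useless.
\<close>


section \<open>Sums of extended nonnegative reals\<close>

lemma infsum_cmult_ennreal: "(\<Sum>\<^sub>\<infinity>x\<in>A. c * f x) = c * infsum f A" for c :: ennreal
proof -
  have "(\<Sum>\<^sub>\<infinity>x\<in>A. c * f x) = (SUP F\<in>{F. finite F \<and> F \<subseteq> A}. c * sum f F)"
    by (simp add: nonneg_infsum_complete sum_distrib_left)
  also have "\<dots> = c * infsum f A"
    by (simp add: nonneg_infsum_complete SUP_mult_left_ennreal)
  finally show ?thesis .
qed

lemma infsum_finite_UN_ennreal:
  fixes f :: "'a \<Rightarrow> ennreal"
  assumes "finite A" "disjoint_family_on B A"
  shows "infsum f (\<Union>x\<in>A. B x) = (\<Sum>x\<in>A. infsum f (B x))"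
  using assms
proof (induction A rule: finite_induct)
  case (insert x A)
  have "B x \<inter> (\<Union>y\<in>A. B y) = {}"
    using insert.prems insert.hyps(2) by (force simp: disjoint_family_on_def)
  then have "infsum f (B x \<union> (\<Union>y\<in>A. B y)) = infsum f (B x) + infsum f (\<Union>y\<in>A. B y)"
    by (intro infsum_Un_disjoint) (simp_all add: nonneg_summable_on_complete)
  with insert show ?case by (simp add: disjoint_family_on_def)
qed simp

lemma infsum_mono_set_ennreal: "A \<subseteq> B \<Longrightarrow> infsum f A \<le> infsum f B" for f :: "'a \<Rightarrow> ennreal"
  by (intro infsum_mono_neutral) (auto simp: nonneg_summable_on_complete)

text \<open>Both sides are compared through finite pieces: a finite partial sum over members is the
  sum over a finite union, and finitely many points lie in the union of finitely many
  members.\<close>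

lemma infsum_UN_ennreal:
  fixes f :: "'a \<Rightarrow> ennreal"
  assumes disj: "disjoint_family_on B A"
  shows "infsum f (\<Union>x\<in>A. B x) = (\<Sum>\<^sub>\<infinity>x\<in>A. infsum f (B x))"
proof (rule antisym)
  have fin: "infsum f (\<Union>x\<in>F. B x) = (\<Sum>x\<in>F. infsum f (B x))" if "finite F" "F \<subseteq> A" for F
    using that disj by (intro infsum_finite_UN_ennreal) (auto simp: disjoint_family_on_def)
  show "(\<Sum>\<^sub>\<infinity>x\<in>A. infsum f (B x)) \<le> infsum f (\<Union>x\<in>A. B x)"
  proof (subst nonneg_infsum_complete, simp, rule SUP_least, clarify)
    fix F assume "finite F" "F \<subseteq> A"
    then show "(\<Sum>x\<in>F. infsum f (B x)) \<le> infsum f (\<Union>x\<in>A. B x)"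
      by (simp flip: fin) (intro infsum_mono_set_ennreal, auto)
  qed
  show "infsum f (\<Union>x\<in>A. B x) \<le> (\<Sum>\<^sub>\<infinity>x\<in>A. infsum f (B x))"
  proof (subst nonneg_infsum_complete, simp, rule SUP_least, clarify)
    fix P assume P: "finite P" "P \<subseteq> (\<Union>x\<in>A. B x)"
    then have "\<forall>p\<in>P. \<exists>x. x \<in> A \<and> p \<in> B x" by blast
    then obtain g where g: "\<forall>p\<in>P. g p \<in> A \<and> p \<in> B (g p)" by (metis bchoice)
    define F where "F = g ` P"
    have F: "F \<subseteq> A" "finite F" "P \<subseteq> (\<Union>x\<in>F. B x)"
      using g P(1) by (auto simp: F_def)
    have "sum f P = infsum f P" using P by simp
    also have "\<dots> \<le> infsum f (\<Union>x\<in>F. B x)" by (rule infsum_mono_set_ennreal[OF F(3)])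
    also have "\<dots> = infsum (\<lambda>x. infsum f (B x)) F" using F fin by simp
    also have "\<dots> \<le> (\<Sum>\<^sub>\<infinity>x\<in>A. infsum f (B x))" by (rule infsum_mono_set_ennreal[OF F(1)])
    finally show "sum f P \<le> (\<Sum>\<^sub>\<infinity>x\<in>A. infsum f (B x))" .
  qed
qed

lemma infsum_Sigma_ennreal:
  fixes f :: "'a \<times> 'b \<Rightarrow> ennreal"
  shows "infsum f (Sigma A B) = (\<Sum>\<^sub>\<infinity>x\<in>A. \<Sum>\<^sub>\<infinity>y\<in>B x. f (x, y))"
proof -
  have "infsum f (\<Union>x\<in>A. Pair x ` B x) = (\<Sum>\<^sub>\<infinity>x\<in>A. infsum f (Pair x ` B x))"
    by (rule infsum_UN_ennreal) (auto simp: disjoint_family_on_def)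
  moreover have "(\<Union>x\<in>A. Pair x ` B x) = Sigma A B" by auto
  ultimately show ?thesis by (simp add: infsum_reindex inj_on_def o_def)
qed


section \<open>Leftmost derivations\<close>

lemma map_T_eq_iff [simp]: "map T u = map T v \<longleftrightarrow> u = v"
  by (simp add: inj_map_eq_map inj_def)

lemma map_T_NT_eq_iff [simp]:
  "map T u @ NT Y # \<mu> = map T u' @ NT Y' # \<mu>' \<longleftrightarrow> u = u' \<and> Y = Y' \<and> \<mu> = \<mu>'"
proof (induction u arbitrary: u')
  case Nil
  then show ?case by (cases u') auto
next
  case (Cons a u)
  then show ?case by (cases u') auto
qed

lemma map_T_neq_NT [simp]: "map T u \<noteq> \<xi> @ NT Y # \<mu>" "\<xi> @ NT Y # \<mu> \<noteq> map T u"
proof -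
  show "map T u \<noteq> \<xi> @ NT Y # \<mu>"
  proof
    assume "map T u = \<xi> @ NT Y # \<mu>"
    then have "NT Y \<in> set (map T u)" by simp
    then show False by auto
  qed
  then show "\<xi> @ NT Y # \<mu> \<noteq> map T u" by metis
qed

lemma sentential_form_cases:
  obtains (word) u where "\<phi> = map T u"
  | (leftmost) u Y \<mu> where "\<phi> = map T u @ NT Y # \<mu>"
proof -
  have "(\<exists>u. \<phi> = map T u) \<or> (\<exists>u Y \<mu>. \<phi> = map T u @ NT Y # \<mu>)"
  proof (induction \<phi>)
    case Nil
    then show ?case by simp
  next
    case (Cons a \<phi>)
    show ?case
    proof (cases a)
      case (NT Y)
      then have "a # \<phi> = map T [] @ NT Y # \<phi>" by simp
      then show ?thesis by blast
    next
      case (T c)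
      then have "a # \<phi> = map T (c # u) @ \<psi>" if "\<phi> = map T u @ \<psi>" for u \<psi>
        using that by simp
      with Cons show ?thesis by (metis append_Nil2)
    qed
  qed
  with that show thesis by blast
qed

lemma leftmost_derivation_Nil_iff [simp]: "leftmost_derivation G \<phi> [] \<psi> \<longleftrightarrow> \<phi> = \<psi>"
  by (auto elim: leftmost_derivation.cases intro: leftmost_derivation.refl)

lemma leftmost_derivation_Cons_iff:
  "leftmost_derivation G \<phi> ((Y, \<nu>) # rs) \<psi> \<longleftrightarrow>
     (Y, \<nu>) \<in> prods G \<and>
     (\<exists>u \<mu>. \<phi> = map T u @ NT Y # \<mu> \<and> leftmost_derivation G (map T u @ \<nu> @ \<mu>) rs \<psi>)"
  by (auto elim: leftmost_derivation.cases intro: leftmost_derivation.step)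

lemma leftmost_derivation_NT_Cons_iff [simp]:
  "leftmost_derivation G (map T u @ NT Y # \<mu>) ((Y', \<nu>) # rs) \<psi> \<longleftrightarrow>
     Y' = Y \<and> (Y, \<nu>) \<in> prods G \<and> leftmost_derivation G (map T u @ \<nu> @ \<mu>) rs \<psi>"
  by (auto simp: leftmost_derivation_Cons_iff)

lemma leftmost_derivation_singleton_Cons_iff [simp]:
  "leftmost_derivation G [NT Y] ((Y', \<nu>) # rs) \<psi> \<longleftrightarrow>
     Y' = Y \<and> (Y, \<nu>) \<in> prods G \<and> leftmost_derivation G \<nu> rs \<psi>"
  using leftmost_derivation_NT_Cons_iff[of G "[]" Y "[]"] by simp

lemma leftmost_derivation_map_T_iff [simp]:
  "leftmost_derivation G (map T u) rs \<psi> \<longleftrightarrow> rs = [] \<and> \<psi> = map T u"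
  by (cases rs) (auto simp: leftmost_derivation_Cons_iff)

lemma leftmost_derivation_append_iff:
  "leftmost_derivation G \<phi> (rs @ rs') \<psi> \<longleftrightarrow>
     (\<exists>\<theta>. leftmost_derivation G \<phi> rs \<theta> \<and> leftmost_derivation G \<theta> rs' \<psi>)"
proof (induction rs arbitrary: \<phi>)
  case Nil
  then show ?case by simp
next
  case (Cons r rs)
  then show ?case by (cases r) (auto simp: leftmost_derivation_Cons_iff)
qed

text \<open>A leftmost step has no choice of position, so the production list alone fixes the
  derivation. Derivations of different words thus form disjoint sets.\<close>

lemma leftmost_derivation_functional:
  assumes "leftmost_derivation G \<phi> rs \<psi>" "leftmost_derivation G \<phi> rs \<psi>'"
  shows "\<psi> = \<psi>'"
  using assms by (induction rule: leftmost_derivation.induct) auto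

lemma leftmost_derivation_prods: "leftmost_derivation G \<phi> rs \<psi> \<Longrightarrow> set rs \<subseteq> prods G"
  by (induction rule: leftmost_derivation.induct) auto

lemma leftmost_derivation_context:
  "leftmost_derivation G \<phi> rs \<psi> \<Longrightarrow>
     leftmost_derivation G (map T v @ \<phi> @ \<mu>') rs (map T v @ \<psi> @ \<mu>')"
proof (induction rule: leftmost_derivation.induct)
  case (step Y \<nu> u \<mu> rs \<psi>)
  then show ?case
    using leftmost_derivation.step[of Y \<nu> G "v @ u" "\<mu> @ \<mu>'"] by simp
qed simp

text \<open>A leftmost derivation turns \<open>\<phi>\<close> into a word before it touches
  \<open>\<psi>\<close>, so its list is cut into two consecutive blocks. In the induction the first
  production belongs to \<open>\<phi>\<close> as long as \<open>\<phi>\<close> contains a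
  nonterminal.\<close>

lemma leftmost_derivation_split:
  assumes "leftmost_derivation G (\<phi> @ \<psi>) rs (map T z)"
  shows "\<exists>rs\<^sub>1 rs\<^sub>2 z\<^sub>1 z\<^sub>2. rs = rs\<^sub>1 @ rs\<^sub>2 \<and> leftmost_derivation G \<phi> rs\<^sub>1 (map T z\<^sub>1) \<and>
           leftmost_derivation G \<psi> rs\<^sub>2 (map T z\<^sub>2)"
  using assms
proof (induction rs arbitrary: \<phi> \<psi>)
  case Nil
  then show ?case
    by (metis append_Nil leftmost_derivation_Nil_iff map_eq_append_conv)
next
  case (Cons r rs)
  obtain Y \<nu> where r: "r = (Y, \<nu>)" by fastforce
  show ?case
  proof (cases \<phi> rule: sentential_form_cases)
    case (word u)
    show ?thesis
    proof (cases \<psi> rule: sentential_form_cases)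
      case (word v)
      with \<open>\<phi> = map T u\<close> Cons.prems have "leftmost_derivation G (map T (u @ v)) (r # rs) (map T z)"
        by simp
      then show ?thesis by (simp only: leftmost_derivation_map_T_iff) simp
    next
      case (leftmost v Y' \<mu>)
      with word Cons.prems
      have "leftmost_derivation G (map T (u @ v) @ NT Y' # \<mu>) ((Y, \<nu>) # rs) (map T z)"
        by (simp add: r)
      then have *: "Y = Y'" "(Y, \<nu>) \<in> prods G"
        "leftmost_derivation G (map T u @ (map T v @ \<nu> @ \<mu>)) rs (map T z)"
        by (simp_all only: leftmost_derivation_NT_Cons_iff) simp
      from Cons.IH[OF *(3)] obtain rs\<^sub>2 z\<^sub>2 where
        "rs = rs\<^sub>2" "leftmost_derivation G (map T v @ \<nu> @ \<mu>) rs\<^sub>2 (map T z\<^sub>2)"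
        by auto
      then have "r # rs = [] @ (r # rs)" "leftmost_derivation G \<psi> (r # rs) (map T z\<^sub>2)"
        "leftmost_derivation G \<phi> [] (map T u)"
        using * word leftmost r by simp_all
      then show ?thesis by blast
    qed
  next
    case (leftmost u Y' \<mu>)
    with Cons.prems have *: "Y = Y'" "(Y, \<nu>) \<in> prods G"
      "leftmost_derivation G ((map T u @ \<nu> @ \<mu>) @ \<psi>) rs (map T z)"
      by (simp_all add: r)
    from Cons.IH[OF *(3)] obtain rs\<^sub>1 rs\<^sub>2 z\<^sub>1 z\<^sub>2 where
      "rs = rs\<^sub>1 @ rs\<^sub>2" "leftmost_derivation G (map T u @ \<nu> @ \<mu>) rs\<^sub>1 (map T z\<^sub>1)"
      "leftmost_derivation G \<psi> rs\<^sub>2 (map T z\<^sub>2)"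
      by blast
    then have "r # rs = (r # rs\<^sub>1) @ rs\<^sub>2" "leftmost_derivation G \<phi> (r # rs\<^sub>1) (map T z\<^sub>1)"
      using leftmost * r by simp_all
    with \<open>leftmost_derivation G \<psi> rs\<^sub>2 (map T z\<^sub>2)\<close> show ?thesis by blast
  qed
qed

lemma leftmost_derivation_terminals:
  assumes "is_scfg G" "leftmost_derivation G \<phi> rs \<psi>"
    "set \<phi> \<subseteq> NT ` nonterms G \<union> T ` terminals G"
  shows "set \<psi> \<subseteq> NT ` nonterms G \<union> T ` terminals G"
  using assms(2,3)
proof (induction rule: leftmost_derivation.induct)
  case (step Y \<nu> u \<mu> rs \<psi>)
  have "set \<nu> \<subseteq> NT ` nonterms G \<union> T ` terminals G"
    using step(1) assms(1) by (auto simp: is_scfg_def)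
  with step show ?case by simp
qed

lemma ennreal_derivation_prob_Cons:
  assumes "is_scfg G" "r \<in> prods G"
  shows "ennreal (derivation_prob G (r # rs)) = ennreal (prod_prob G r) * ennreal (derivation_prob G rs)"
  using assms by (simp add: derivation_prob_def is_scfg_def ennreal_mult')

lemma derivation_prob_nonneg:
  assumes "is_scfg G" "set rs \<subseteq> prods G"
  shows "0 \<le> derivation_prob G rs"
  using assms unfolding derivation_prob_def is_scfg_def by (intro prod_list_nonneg) auto

lemma derivation_prob_append:
  "derivation_prob G (rs @ rs') = derivation_prob G rs * derivation_prob G rs'"
  by (simp add: derivation_prob_def)

lemma ennreal_derivation_prob_append:
  assumes "is_scfg G" "set rs \<subseteq> prods G"
  shows "ennreal (derivation_prob G (rs @ rs')) =
    ennreal (derivation_prob G rs) * ennreal (derivation_prob G rs')"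
  using derivation_prob_nonneg[OF assms] by (simp add: derivation_prob_append ennreal_mult')


section \<open>Termination probabilities\<close>

definition terminating :: "('n, 't) scfg \<Rightarrow> ('n, 't) sym list \<Rightarrow> ('n, 't) production list set" where
  "terminating G \<phi> = {rs. \<exists>z. leftmost_derivation G \<phi> rs (map T z)}"

definition termination_prob :: "('n, 't) scfg \<Rightarrow> ('n, 't) sym list \<Rightarrow> ennreal" where
  "termination_prob G \<phi> = (\<Sum>\<^sub>\<infinity>rs\<in>terminating G \<phi>. ennreal (derivation_prob G rs))"

lemma terminating_map_T [simp]: "terminating G (map T u) = {[]}"
  by (auto simp: terminating_def)

lemma termination_prob_map_T [simp]: "termination_prob G (map T u) = 1"
  by (simp add: termination_prob_def derivation_prob_def)

text \<open>The derivations in \<open>F\<close> are sorted by their first production. Subsets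
  \<open>F\<close> are allowed so that the identity also serves derivations of bounded length in
  \<open>termination_prob_le_1\<close>.\<close>

lemma infsum_terminating_step:
  assumes G: "is_scfg G" and F: "F \<subseteq> terminating G (map T u @ NT Y # \<mu>)"
  shows "(\<Sum>\<^sub>\<infinity>rs\<in>F. ennreal (derivation_prob G rs)) =
    (\<Sum>\<nu> | (Y, \<nu>) \<in> prods G. ennreal (prod_prob G (Y, \<nu>)) *
       (\<Sum>\<^sub>\<infinity>rs\<in>{rs. (Y, \<nu>) # rs \<in> F}. ennreal (derivation_prob G rs)))"
    (is "_ = (\<Sum>\<nu> | _. _ * infsum ?f (?B \<nu>))")
proof -
  let ?A = "{\<nu>. (Y, \<nu>) \<in> prods G}"
  have fin: "finite ?A"
    using G finite_vimageI[of "prods G" "Pair Y"] by (simp add: is_scfg_def vimage_def inj_def)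
  have F_eq: "F = (\<Union>\<nu>\<in>?A. (#) (Y, \<nu>) ` ?B \<nu>)"
  proof (intro equalityI subsetI)
    fix rs assume rs: "rs \<in> F"
    with F obtain z where z: "leftmost_derivation G (map T u @ NT Y # \<mu>) rs (map T z)"
      by (auto simp: terminating_def)
    then obtain r rs' where "rs = r # rs'" by (cases rs) auto
    with rs z show "rs \<in> (\<Union>\<nu>\<in>?A. (#) (Y, \<nu>) ` ?B \<nu>)" by (cases r) auto
  qed auto
  have "infsum ?f F = (\<Sum>\<nu>\<in>?A. infsum ?f ((#) (Y, \<nu>) ` ?B \<nu>))"
    by (subst F_eq, rule infsum_finite_UN_ennreal[OF fin]) (auto simp: disjoint_family_on_def)
  also have "\<dots> = (\<Sum>\<nu>\<in>?A. \<Sum>\<^sub>\<infinity>rs\<in>?B \<nu>. ennreal (prod_prob G (Y, \<nu>)) * ?f rs)"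
    by (rule sum.cong)
      (auto simp: infsum_reindex ennreal_derivation_prob_Cons[OF G] intro!: infsum_cong)
  finally show ?thesis by (simp add: infsum_cmult_ennreal)
qed

lemma termination_prob_step:
  assumes "is_scfg G"
  shows "termination_prob G (map T u @ NT Y # \<mu>) =
    (\<Sum>\<nu> | (Y, \<nu>) \<in> prods G. ennreal (prod_prob G (Y, \<nu>)) * termination_prob G (map T u @ \<nu> @ \<mu>))"
proof -
  have "{rs. (Y, \<nu>) # rs \<in> terminating G (map T u @ NT Y # \<mu>)} = terminating G (map T u @ \<nu> @ \<mu>)"
    if "(Y, \<nu>) \<in> prods G" for \<nu>
    using that by (auto simp: terminating_def)
  then show ?thesis
    unfolding termination_prob_def infsum_terminating_step[OF assms order_refl]
    by (intro sum.cong) auto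
qed

lemma sum_prod_prob:
  assumes "is_scfg G" "proper G" "Y \<in> nonterms G"
  shows "(\<Sum>\<nu> | (Y, \<nu>) \<in> prods G. ennreal (prod_prob G (Y, \<nu>))) = 1"
proof -
  have "(\<Sum>\<nu> | (Y, \<nu>) \<in> prods G. ennreal (prod_prob G (Y, \<nu>))) =
      ennreal (\<Sum>\<nu> | (Y, \<nu>) \<in> prods G. prod_prob G (Y, \<nu>))"
    using assms(1) by (intro sum_ennreal) (auto simp: is_scfg_def)
  then show ?thesis using assms(2,3) by (simp add: proper_def)
qed

text \<open>Induction on a strict length bound \<open>n\<close>: splitting off the first production
  bounds the sum by an average of sums that are at most 1, the weights adding up to 1 by properness.
  Every finite partial sum of the full series has such a length bound.\<close>

lemma termination_prob_le_1:
  assumes G: "is_scfg G" "proper G"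
  shows "termination_prob G \<phi> \<le> 1"
proof -
  have *: "(\<Sum>\<^sub>\<infinity>rs\<in>F. ennreal (derivation_prob G rs)) \<le> 1"
    if "F \<subseteq> terminating G \<phi>" "\<forall>rs\<in>F. length rs < n" for n F \<phi>
    using that
  proof (induction n arbitrary: F \<phi>)
    case 0
    then have "F = {}" by auto
    then show ?case by simp
  next
    case (Suc n)
    show ?case
    proof (cases \<phi> rule: sentential_form_cases)
      case (word u)
      with Suc.prems have "F \<subseteq> {[]}" by simp
      then have "F = {} \<or> F = {[]}" by blast
      then show ?thesis by (auto simp: derivation_prob_def)
    next
      case (leftmost u Y \<mu>)
      have le: "(\<Sum>\<^sub>\<infinity>rs\<in>{rs. (Y, \<nu>) # rs \<in> F}. ennreal (derivation_prob G rs)) \<le> 1" for \<nu>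
      proof (rule Suc.IH)
        show "{rs. (Y, \<nu>) # rs \<in> F} \<subseteq> terminating G (map T u @ \<nu> @ \<mu>)"
          using subsetD[OF Suc.prems(1)] by (force simp: leftmost terminating_def)
      qed (use Suc.prems(2) in auto)
      have "(\<Sum>\<^sub>\<infinity>rs\<in>F. ennreal (derivation_prob G rs)) \<le>
          (\<Sum>\<nu> | (Y, \<nu>) \<in> prods G. ennreal (prod_prob G (Y, \<nu>)) * 1)"
        unfolding infsum_terminating_step[OF G(1) Suc.prems(1)[unfolded leftmost]]
        by (intro sum_mono mult_left_mono le) auto
      also have "\<dots> \<le> 1"
      proof (cases "Y \<in> nonterms G")
        case True
        with G show ?thesis by (simp add: sum_prod_prob)
      next
        \<comment> \<open>\<open>\<phi>\<close> is arbitrary, so \<open>Y\<close> may lie outside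
          the grammar; it then has no productions and the sum is empty.\<close>
        case False
        with G have "{\<nu>. (Y, \<nu>) \<in> prods G} = {}" by (auto simp: is_scfg_def)
        then show ?thesis by simp
      qed
      finally show ?thesis .
    qed
  qed
  show ?thesis
    unfolding termination_prob_def
  proof (subst nonneg_infsum_complete, simp, rule SUP_least, clarify)
    fix F assume F: "finite F" "F \<subseteq> terminating G \<phi>"
    then have "\<forall>rs\<in>F. length rs < Suc (Max (length ` F))"
      by (auto simp: less_Suc_eq_le)
    from *[OF F(2) this] F(1)
    show "(\<Sum>rs\<in>F. ennreal (derivation_prob G rs)) \<le> 1" by simp
  qed
qed

text \<open>The lists that terminate \<open>\<phi>\<close> form a prefix-free set, because a word
  admits no further step; hence the place of the cut is unique. Its existence is
  \<open>leftmost_derivation_split\<close>.\<close>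

lemma bij_betw_terminating_append:
  "bij_betw (\<lambda>(rs\<^sub>1, rs\<^sub>2). rs\<^sub>1 @ rs\<^sub>2) (terminating G \<phi> \<times> terminating G \<psi>)
     (terminating G (\<phi> @ \<psi>))"
proof -
  have unique: "rs\<^sub>1 = rs\<^sub>1'" if "rs\<^sub>1 \<in> terminating G \<phi>" "rs\<^sub>1' \<in> terminating G \<phi>" "prefix rs\<^sub>1 rs\<^sub>1'"
    for rs\<^sub>1 rs\<^sub>1'
  proof -
    from that obtain rs where rs: "rs\<^sub>1' = rs\<^sub>1 @ rs" by (auto elim: prefixE)
    with that(2) obtain \<theta> z' where "leftmost_derivation G \<phi> rs\<^sub>1 \<theta>"
      "leftmost_derivation G \<theta> rs (map T z')"
      by (auto simp: terminating_def leftmost_derivation_append_iff)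
    with that(1) have "rs = []"
      by (auto simp: terminating_def dest: leftmost_derivation_functional)
    with rs show ?thesis by simp
  qed
  have inj: "inj_on (\<lambda>(rs\<^sub>1, rs\<^sub>2). rs\<^sub>1 @ rs\<^sub>2) (terminating G \<phi> \<times> terminating G \<psi>)"
  proof (rule inj_onI, clarify)
    fix a b a' b'
    assume *: "a \<in> terminating G \<phi>" "a' \<in> terminating G \<phi>" and eq: "a @ b = a' @ b'"
    from eq have "prefix a a' \<or> prefix a' a"
      by (metis prefixI prefix_same_cases)
    with * have "a = a'" using unique by blast
    with eq show "a = a' \<and> b = b'" by simp
  qed
  have "rs\<^sub>1 @ rs\<^sub>2 \<in> terminating G (\<phi> @ \<psi>)"
    if "rs\<^sub>1 \<in> terminating G \<phi>" "rs\<^sub>2 \<in> terminating G \<psi>" for rs\<^sub>1 rs\<^sub>2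
  proof -
    from that obtain z\<^sub>1 z\<^sub>2 where z: "leftmost_derivation G \<phi> rs\<^sub>1 (map T z\<^sub>1)"
      "leftmost_derivation G \<psi> rs\<^sub>2 (map T z\<^sub>2)"
      by (auto simp: terminating_def)
    from leftmost_derivation_context[OF z(1), of "[]" \<psi>]
      leftmost_derivation_context[OF z(2), of z\<^sub>1 "[]"]
    have "leftmost_derivation G (\<phi> @ \<psi>) (rs\<^sub>1 @ rs\<^sub>2) (map T (z\<^sub>1 @ z\<^sub>2))"
      by (auto simp: leftmost_derivation_append_iff)
    then show ?thesis unfolding terminating_def by blast
  qed
  moreover have "rs \<in> (\<lambda>(rs\<^sub>1, rs\<^sub>2). rs\<^sub>1 @ rs\<^sub>2) ` (terminating G \<phi> \<times> terminating G \<psi>)"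
    if "rs \<in> terminating G (\<phi> @ \<psi>)" for rs
    using that leftmost_derivation_split[of G \<phi> \<psi> rs] by (fastforce simp: terminating_def)
  ultimately show ?thesis
    using inj by (auto simp: bij_betw_def)
qed

lemma termination_prob_append:
  assumes "is_scfg G"
  shows "termination_prob G (\<phi> @ \<psi>) = termination_prob G \<phi> * termination_prob G \<psi>"
proof -
  have "termination_prob G (\<phi> @ \<psi>) =
    (\<Sum>\<^sub>\<infinity>p\<in>terminating G \<phi> \<times> terminating G \<psi>. ennreal (derivation_prob G (fst p @ snd p)))"
    unfolding termination_prob_def
    using infsum_reindex_bij_betw[OF bij_betw_terminating_append,
        of "\<lambda>rs. ennreal (derivation_prob G rs)" G \<phi> \<psi>]
    by (simp add: case_prod_beta)
  also have "\<dots> = (\<Sum>\<^sub>\<infinity>rs\<in>terminating G \<phi>. \<Sum>\<^sub>\<infinity>rs'\<in>terminating G \<psi>.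
      ennreal (derivation_prob G (rs @ rs')))"
    by (simp add: infsum_Sigma_ennreal)
  also have "\<dots> = (\<Sum>\<^sub>\<infinity>rs\<in>terminating G \<phi>. termination_prob G \<psi> * ennreal (derivation_prob G rs))"
  proof (rule infsum_cong)
    fix rs assume "rs \<in> terminating G \<phi>"
    then have "set rs \<subseteq> prods G" by (auto simp: terminating_def dest: leftmost_derivation_prods)
    then show "(\<Sum>\<^sub>\<infinity>rs'\<in>terminating G \<psi>. ennreal (derivation_prob G (rs @ rs'))) =
      termination_prob G \<psi> * ennreal (derivation_prob G rs)"
      by (simp add: termination_prob_def ennreal_derivation_prob_append[OF assms]
          infsum_cmult_ennreal mult.commute[of "infsum _ _"])
  qed
  also have "\<dots> = termination_prob G \<phi> * termination_prob G \<psi>"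
    unfolding infsum_cmult_ennreal by (simp add: termination_prob_def mult.commute)
  finally show ?thesis .
qed

section \<open>Symbols that terminate with probability 1\<close>

lemma add_less_le_mono_ennreal:
  fixes a b c d :: ennreal
  assumes "a < b" "c \<le> d" "d \<noteq> top"
  shows "a + c < b + d"
proof -
  have "a + c \<le> d + a" using assms(2) by (simp add: add.commute[of d] add_left_mono)
  also have "\<dots> < d + b" using assms by (simp add: ennreal_add_left_cancel_less)
  finally show ?thesis by (simp add: add.commute)
qed

lemma mult_eq_1_ennreal_le_1:
  fixes a b :: ennreal
  assumes "a * b = 1" "a \<le> 1" "b \<le> 1"
  shows "a = 1" "b = 1"
  using assms mult_mono[of a a b 1] mult_mono[of a 1 b b] by auto

text \<open>By multiplicativity the value is a product over the symbols, terminals contributing 1.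
  As no factor exceeds 1, the product is 1 only if every factor is.\<close>

lemma termination_prob_eq_1_iff:
  assumes G: "is_scfg G" "proper G"
  shows "termination_prob G \<phi> = 1 \<longleftrightarrow> (\<forall>Y. NT Y \<in> set \<phi> \<longrightarrow> termination_prob G [NT Y] = 1)"
proof (induction \<phi>)
  case Nil
  then show ?case using termination_prob_map_T[of G "[]"] by simp
next
  case (Cons a \<phi>)
  have a: "termination_prob G (a # \<phi>) = termination_prob G [a] * termination_prob G \<phi>"
    using termination_prob_append[OF G(1), of "[a]" \<phi>] by simp
  have "termination_prob G (a # \<phi>) = 1 \<longleftrightarrow> termination_prob G [a] = 1 \<and> termination_prob G \<phi> = 1"
    unfolding a using mult_eq_1_ennreal_le_1[OF _ termination_prob_le_1[OF G] termination_prob_le_1[OF G]]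
    by (metis mult_1)
  moreover have "termination_prob G [a] = 1" if "a = T c" for c
    using termination_prob_map_T[of G "[c]"] that by simp
  ultimately show ?case using Cons by (cases a) auto
qed

text \<open>The termination probability of \<open>Y\<close> is an average, with weights
  \<open>prod_prob\<close>, of values at most 1. A smaller value of nonzero weight would push it
  below 1.\<close>

lemma termination_prob_production:
  assumes G: "is_scfg G" "proper G"
    and r: "(Y, \<nu>) \<in> prods G" "prod_prob G (Y, \<nu>) \<noteq> 0"
    and Y: "termination_prob G [NT Y] = 1"
  shows "termination_prob G \<nu> = 1"
proof (rule ccontr)
  let ?A = "{\<nu>. (Y, \<nu>) \<in> prods G}"
  let ?t = "\<lambda>\<nu>. termination_prob G \<nu>" and ?P = "\<lambda>\<nu>. prod_prob G (Y, \<nu>)"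
  assume "?t \<nu> \<noteq> 1"
  with termination_prob_le_1[OF G, of \<nu>] have less: "?t \<nu> < 1" by simp
  have fin: "finite ?A"
    using G(1) finite_vimageI[of "prods G" "Pair Y"] by (simp add: is_scfg_def vimage_def inj_def)
  have YN: "Y \<in> nonterms G" using G(1) r(1) by (auto simp: is_scfg_def)
  have P: "0 \<le> ?P \<nu>" using G(1) r(1) by (auto simp: is_scfg_def)
  have "ennreal (?P \<nu>) * ?t \<nu> < ennreal (?P \<nu>) * 1"
    using less r(2) P by (intro ennreal_mult_strict_left_mono) (auto simp: ennreal_zero_less_mult_iff)
  moreover have "(\<Sum>\<nu>\<in>?A - {\<nu>}. ennreal (?P \<nu>) * ?t \<nu>) \<le> (\<Sum>\<nu>\<in>?A - {\<nu>}. ennreal (?P \<nu>) * 1)"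
    by (intro sum_mono mult_left_mono termination_prob_le_1 G) auto
  moreover have "(\<Sum>\<nu>\<in>?A - {\<nu>}. ennreal (?P \<nu>) * 1) \<noteq> top"
    using fin by (simp flip: less_top)
  ultimately have "ennreal (?P \<nu>) * ?t \<nu> + (\<Sum>\<nu>\<in>?A - {\<nu>}. ennreal (?P \<nu>) * ?t \<nu>)
      < ennreal (?P \<nu>) * 1 + (\<Sum>\<nu>\<in>?A - {\<nu>}. ennreal (?P \<nu>) * 1)"
    by (rule add_less_le_mono_ennreal)
  then have "(\<Sum>\<nu>\<in>?A. ennreal (?P \<nu>) * ?t \<nu>) < (\<Sum>\<nu>\<in>?A. ennreal (?P \<nu>) * 1)"
    using r(1) by (simp add: sum.remove[OF fin, of \<nu>])
  \<comment> \<open>The left sum is the termination probability of \<open>Y\<close>, the right one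
    the total weight; both equal 1.\<close>
  then show False
    using sum_prod_prob[OF G YN] termination_prob_step[OF G(1), of "[]" Y "[]"] Y by simp
qed

text \<open>Stated for derivations in arbitrary order, as these occur in
  \<open>no_useless_nonterminals\<close>. The rewritten nonterminal may stand anywhere, since by
  \<open>termination_prob_eq_1_iff\<close> all symbols of the form terminate with probability
  1.\<close>

lemma termination_prob_derivation:
  assumes G: "is_scfg G" "proper G"
    and "derivation G \<phi> rs \<psi>" "derivation_prob G rs \<noteq> 0" "termination_prob G \<phi> = 1"
  shows "termination_prob G \<psi> = 1"
  using assms(3-)
proof (induction rule: derivation.induct)
  case (step Y \<nu> \<xi> \<mu> rs \<psi>)
  note iff = termination_prob_eq_1_iff[OF G]
  from step have "termination_prob G [NT Y] = 1" "prod_prob G (Y, \<nu>) \<noteq> 0"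
    by (auto simp: iff[of "\<xi> @ NT Y # \<mu>"] derivation_prob_def)
  with termination_prob_production[OF G step(1)] have "termination_prob G \<nu> = 1" by blast
  with step.prems have "termination_prob G (\<xi> @ \<nu> @ \<mu>) = 1"
    unfolding iff[of "\<xi> @ \<nu> @ \<mu>"] iff[of \<nu>] iff[of "\<xi> @ NT Y # \<mu>"] by auto
  with step show ?case by (simp add: derivation_prob_def)
qed

text \<open>Sorting the terminating derivations by the derived word, which lies over
  \<open>terminals G\<close>, gives the sum that \<open>consistent\<close> sets to 1.\<close>

lemma termination_prob_start:
  assumes G: "is_scfg G" "consistent G"
  shows "termination_prob G [NT (start G)] = 1"
proof -
  let ?B = "\<lambda>z. {rs. leftmost_derivation G [NT (start G)] rs (map T z)}"
  have "z \<in> lists (terminals G)" if "rs \<in> ?B z" for z rs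
    using leftmost_derivation_terminals[OF G(1), of "[NT (start G)]" rs "map T z"] that G(1)
    by (auto simp: is_scfg_def)
  then have "terminating G [NT (start G)] = (\<Union>z\<in>lists (terminals G). ?B z)"
    by (auto simp: terminating_def)
  moreover have "disjoint_family_on ?B (lists (terminals G))"
    by (auto simp: disjoint_family_on_def dest: leftmost_derivation_functional)
  ultimately show ?thesis
    using G(2) by (simp add: termination_prob_def consistent_def string_prob_def infsum_UN_ennreal)
qed

lemma termination_prob_eq_1:
  assumes G: "is_scfg G" "proper G" "consistent G" "no_useless_nonterminals G"
    and \<phi>: "set \<phi> \<subseteq> NT ` nonterms G \<union> T ` terminals G"
  shows "termination_prob G \<phi> = 1"
  unfolding termination_prob_eq_1_iff[OF G(1,2), of \<phi>]
proof (intro allI impI)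
  fix Y assume "NT Y \<in> set \<phi>"
  with \<phi> have "Y \<in> nonterms G" by auto
  with G(4) obtain \<xi> \<mu> rs rs' where "derivation G [NT (start G)] rs (\<xi> @ NT Y # \<mu>)"
    "derivation_prob G (rs @ rs') \<noteq> 0"
    unfolding no_useless_nonterminals_def by blast
  with termination_prob_derivation[OF G(1,2)] termination_prob_start[OF G(1,3)]
  have "termination_prob G (\<xi> @ NT Y # \<mu>) = 1" by (auto simp: derivation_prob_append)
  then show "termination_prob G [NT Y] = 1" 
    by (simp add: termination_prob_eq_1_iff[OF G(1,2), of "\<xi> @ NT Y # \<mu>"])
qed


section \<open>Paths as leftmost derivations\<close>

type_synonym ('n, 't) path = "(('n, 't) state \<times> nat) list"

text \<open>The step rules of \<open>path\<close> without the demand that \<open>p\<close> is a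
  path, so that \<open>path_snoc_iff\<close> can extend or cut a path by one uniform rule.\<close>

inductive path_step :: "('n, 't) scfg \<Rightarrow> ('n, 't) path \<Rightarrow> ('n, 't) state \<times> nat \<Rightarrow> bool" for G p where
  prediction: "last p = (State i k X \<xi> (NT Y # \<mu>), r) \<Longrightarrow> (Y, \<nu>) \<in> prods G \<Longrightarrow>
    path_step G p (State i i (Some Y) [] \<nu>, length p)"
| scanning: "last p = (State i k X \<xi> (T a # \<mu>), r) \<Longrightarrow>
    path_step G p (State (i + 1) k X (\<xi> @ [T a]) \<mu>, r)"
| completion: "last p = (State i j (Some Y) \<nu> [], r) \<Longrightarrow> r > 0 \<Longrightarrow>
    p ! (r - 1) = (State j k X \<xi> (NT Y # \<mu>), r') \<Longrightarrow>
    path_step G p (State i k X (\<xi> @ [NT Y]) \<mu>, r')"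

lemmas path_step_scanning = path_step.scanning[unfolded Suc_eq_plus1[symmetric]]

lemma path_not_Nil: "path G p \<Longrightarrow> p \<noteq> []"
  by (induction rule: path.induct) auto

lemma path_single_iff [simp]:
  "path G [(s, r)] \<longleftrightarrow> r = 0 \<and> (s = initial_state G \<or> predicted_state G s)"
proof
  assume "path G [(s, r)]"
  then show "r = 0 \<and> (s = initial_state G \<or> predicted_state G s)"
    by (cases rule: path.cases) (auto dest: path_not_Nil)
qed (auto intro: path.init)

lemma path_snoc_iff:
  assumes "p \<noteq> []"
  shows "path G (p @ [e]) \<longleftrightarrow> path G p \<and> path_step G p e"
proof
  assume "path G (p @ [e])"
  then show "path G p \<and> path_step G p e"
    by (cases rule: path.cases) (use assms in \<open>auto intro: path_step.intros path_step_scanning\<close>)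
next
  assume *: "path G p \<and> path_step G p e"
  from conjunct2[OF this] show "path G (p @ [e])"
    by cases (use * in \<open>fastforce intro: path.intros(2-)\<close>)+
qed

lemma path_induct [consumes 1, case_names start step]:
  assumes "path G p"
    and "\<And>s. s = initial_state G \<or> predicted_state G s \<Longrightarrow> P [(s, 0)]"
    and "\<And>p e. path G p \<Longrightarrow> path_step G p e \<Longrightarrow> P p \<Longrightarrow> P (p @ [e])"
  shows "P p"
  using assms(1)
proof (induction p rule: path.induct)
  case (init s)
  then show ?case by (rule assms(2))
qed (rule assms(3), assumption, (rule path_step.intros; assumption), assumption)+

lemma path_appendD: "path G (p @ q) \<Longrightarrow> p \<noteq> [] \<Longrightarrow> path G p"
  by (induction q rule: rev_induct) (auto simp: path_snoc_iff simp flip: append_assoc)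

text \<open>The production list that a path represents as a leftmost derivation. The initial state
  contributes nothing, and \<open>the\<close> is safe because predicted states have a nonterminal on
  the left.\<close>

definition expansions :: "('n, 't) scfg \<Rightarrow> ('n, 't) path \<Rightarrow> ('n, 't) production list" where
  "expansions G p = map (\<lambda>(s, r). (the (lhs s), after s)) (filter (\<lambda>(s, r). predicted_state G s) p)"

lemma expansions_Nil [simp]: "expansions G [] = []"
  and expansions_append [simp]: "expansions G (p @ q) = expansions G p @ expansions G q"
  by (simp_all add: expansions_def)

lemma path_prob_eq: "path_prob G p = derivation_prob G (expansions G p)"
  by (simp add: path_prob_def derivation_prob_def expansions_def o_def split_def)

lemma expansions_single [simp]:
  "expansions G [(State i k X (\<xi> @ [a]) \<mu>, r)] = []"
  "expansions G [(State i k None \<xi> \<mu>, r)] = []"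
  "(Y, \<nu>) \<in> prods G \<Longrightarrow> expansions G [(State i i (Some Y) [] \<nu>, r)] = [(Y, \<nu>)]"
  by (auto simp: expansions_def predicted_state_def)

lemma generated_string_Nil [simp]: "generated_string [] = []"
  and generated_string_append [simp]:
    "generated_string (p @ q) = generated_string p @ generated_string q"
  by (simp_all add: generated_string_def)

lemma scanned_state_simps [simp]:
  "\<not> scanned_state (State i k X [] \<mu>)"
  "\<not> scanned_state (State i k X (\<xi> @ [NT Y]) \<mu>)"
  "scanned_state (State i k X (\<xi> @ [T a]) \<mu>)"
  by (simp_all add: scanned_state_def)

lemma generated_string_single [simp]:
  "\<not> scanned_state s \<Longrightarrow> generated_string [(s, r)] = []"
  "generated_string [(State i k X (\<xi> @ [T a]) \<mu>, r)] = [a]"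
  by (simp_all add: generated_string_def)

lemma path_length_eq: "path_length p = length (generated_string p)"
  by (simp add: path_length_def generated_string_def)

lemma generated_string_eq_Nil_iff:
  "generated_string p = [] \<longleftrightarrow> (\<forall>(s, r)\<in>set p. \<not> scanned_state s)"
  by (auto simp: generated_string_def filter_empty_conv)

text \<open>
  The root indices turn a path into a stack: the state at position \<open>r - 1\<close> is the one waiting for
  the expansion with root index \<open>r\<close>. \<open>pending p r\<close> collects what remains to be processed
  in the waiting states. Root indices do not exceed the position at which they occur, so the test
  in the recursive case, which ensures termination, always succeeds on paths.
\<close>

function pending :: "('n, 't) path \<Rightarrow> nat \<Rightarrow> ('n, 't) sym list" where
  "pending p r =
    (if 0 < r \<and> snd (p ! (r - 1)) < r
     then tl (after (fst (p ! (r - 1)))) @ pending p (snd (p ! (r - 1))) else [])"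
  by pat_completeness auto
termination by (relation "Wellfounded.measure snd") auto

declare pending.simps [simp del]

lemma pending_0 [simp]: "pending p 0 = []"
  by (simp add: pending.simps)

text \<open>The recursion looks only at positions below \<open>r\<close>, which appending leaves
  unchanged.\<close>

lemma pending_append: "r \<le> length p \<Longrightarrow> pending (p @ q) r = pending p r"
proof (induction r rule: less_induct)
  case (less r)
  show ?case
  proof (cases "0 < r \<and> snd (p ! (r - 1)) < r")
    case True
    moreover from this less.prems have "(p @ q) ! (r - 1) = p ! (r - 1)"
      by (auto simp: nth_append)
    ultimately show ?thesis
      using less by (simp add: pending.simps[of _ r])
  next
    case False
    moreover from this less.prems have "r > 0 \<Longrightarrow> (p @ q) ! (r - 1) = p ! (r - 1)"
      by (auto simp: nth_append)
    ultimately show ?thesis by (auto simp: pending.simps[of _ r])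
  qed
qed

text \<open>From left to right: the word scanned so far, what follows the dot in the current state,
  and the remainders of the waiting states from the innermost to the outermost.\<close>

definition sentential_form :: "('n, 't) path \<Rightarrow> ('n, 't) sym list" where
  "sentential_form p =
    map T (generated_string p) @ after (fst (last p)) @ pending p (snd (last p))"

text \<open>The root index leads back to the start of the current rule, and for a positive index the
  position before holds the state waiting for its left-hand side. The claims are proved together
  because completion jumps back to a waiting state and takes over its root index.\<close>

lemma path_nth:
  assumes "path G p" "t < length p" "p ! t = (State i k X \<xi> \<mu>, r)"
  shows "r \<le> t" "p ! r = (State k k X [] (\<xi> @ \<mu>), r)"
    "r = 0 \<Longrightarrow> fst (hd p) = State k k X [] (\<xi> @ \<mu>)"
    "r > 0 \<Longrightarrow> \<exists>Y k' X' \<xi>' \<mu>' r'. X = Some Y \<and> p ! (r - 1) = (State k k' X' \<xi>' (NT Y # \<mu>'), r')"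
    "case X of None \<Rightarrow> \<xi> @ \<mu> = [NT (start G)] \<and> k = 0 | Some Y \<Rightarrow> (Y, \<xi> @ \<mu>) \<in> prods G"
proof -
  have "r \<le> t \<and> p ! r = (State k k X [] (\<xi> @ \<mu>), r) \<and>
    (r > 0 \<longrightarrow> (\<exists>Y k' X' \<xi>' \<mu>' r'. X = Some Y \<and> p ! (r - 1) = (State k k' X' \<xi>' (NT Y # \<mu>'), r'))) \<and>
    (case X of None \<Rightarrow> \<xi> @ \<mu> = [NT (start G)] \<and> k = 0 | Some Y \<Rightarrow> (Y, \<xi> @ \<mu>) \<in> prods G)"
    using assms
  proof (induction arbitrary: t i k X \<xi> \<mu> r rule: path_induct)
    case (start s)
    then show ?case by (auto simp: initial_state_def predicted_state_def)
  next
    case (step p e)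
    from step(1) have ne: "p \<noteq> []" by (rule path_not_Nil)
    show ?case
    proof (cases "t < length p")
      case True
      with step.prems have "p ! t = (State i k X \<xi> \<mu>, r)" by (simp add: nth_append)
      from step.IH[OF True this] True show ?thesis by (auto simp: nth_append)
    next
      case False
      with step.prems have t: "t = length p" and e: "e = (State i k X \<xi> \<mu>, r)"
        by (auto simp: nth_append less_Suc_eq)
      from ne have last: "last p = p ! (length p - 1)" "length p - 1 < length p"
        by (simp_all add: last_conv_nth)
      from step(2) show ?thesis
      proof cases
        case (prediction i' k' X' \<xi>' Y \<mu>' r' \<nu>)
        then show ?thesis using ne t last e by (auto simp: nth_append)
      next
        case (scanning i' k' X' \<xi>' a \<mu>' r')
        from step.IH[OF last(2), unfolded last(1)[symmetric], OF scanning(2)] last(2) scanning e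
        show ?thesis by (auto simp: nth_append t split: option.splits)
      next
        case (completion i' j Y \<nu> r\<^sub>0 k' X' \<xi>' \<mu>' r')
        \<comment> \<open>The hypothesis is used twice: at the last state, to see that the waiting
          state lies inside \<open>p\<close>, and then at the waiting state, whose claims pass to
          the new state.\<close>
        from step.IH[OF last(2), unfolded last(1)[symmetric], OF completion(2)] completion last(2)
        have "r\<^sub>0 - 1 < length p" by auto
        from step.IH[OF this completion(4)] completion this e
        show ?thesis by (auto simp: nth_append t split: option.splits)
      qed
    qed
  qed
  then show "r \<le> t" "p ! r = (State k k X [] (\<xi> @ \<mu>), r)"
    "r = 0 \<Longrightarrow> fst (hd p) = State k k X [] (\<xi> @ \<mu>)"
    "r > 0 \<Longrightarrow> \<exists>Y k' X' \<xi>' \<mu>' r'. X = Some Y \<and> p ! (r - 1) = (State k k' X' \<xi>' (NT Y # \<mu>'), r')"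
    "case X of None \<Rightarrow> \<xi> @ \<mu> = [NT (start G)] \<and> k = 0 | Some Y \<Rightarrow> (Y, \<xi> @ \<mu>) \<in> prods G"
    using path_not_Nil[OF assms(1)] by (auto simp: hd_conv_nth)
qed

lemma path_last:
  assumes "path G p" "last p = (State i k X \<xi> \<mu>, r)"
  shows "r < length p"
    "r = 0 \<Longrightarrow> fst (hd p) = State k k X [] (\<xi> @ \<mu>)"
    "r > 0 \<Longrightarrow> \<exists>Y k' X' \<xi>' \<mu>' r'. X = Some Y \<and> p ! (r - 1) = (State k k' X' \<xi>' (NT Y # \<mu>'), r')"
    "case X of None \<Rightarrow> \<xi> @ \<mu> = [NT (start G)] \<and> k = 0 | Some Y \<Rightarrow> (Y, \<xi> @ \<mu>) \<in> prods G"
proof -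
  have "p \<noteq> []" using assms(1) by (rule path_not_Nil)
  then have t: "length p - 1 < length p" "p ! (length p - 1) = (State i k X \<xi> \<mu>, r)"
    using assms(2) by (simp_all add: last_conv_nth)
  note * = path_nth[OF assms(1) t]
  show "r < length p" using *(1) t(1) by simp
  show "r = 0 \<Longrightarrow> fst (hd p) = State k k X [] (\<xi> @ \<mu>)" by (rule *(3))
  show "r > 0 \<Longrightarrow> \<exists>Y k' X' \<xi>' \<mu>' r'. X = Some Y \<and> p ! (r - 1) = (State k k' X' \<xi>' (NT Y # \<mu>'), r')"
    by (rule *(4))
  show "case X of None \<Rightarrow> \<xi> @ \<mu> = [NT (start G)] \<and> k = 0 | Some Y \<Rightarrow> (Y, \<xi> @ \<mu>) \<in> prods G"
    by (rule *(5))
qed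


lemma path_pos:
  assumes "path G p"
  shows "pos (fst (last p)) = origin (fst (hd p)) + length (generated_string p)"
  using assms
proof (induction rule: path_induct)
  case (start s)
  then show ?case by (auto simp: initial_state_def predicted_state_def)
next
  case (step p e)
  from step(2) show ?case
    by cases (use step path_not_Nil[OF step(1)] in auto)
qed

text \<open>Prediction rewrites the leftmost nonterminal and pushes the rest of the predicting state
  on the stack. Scanning moves a letter from the remainder to the word, and completion replaces an
  empty remainder by the top of the stack; neither changes the form.\<close>

lemma sentential_form_step:
  assumes "path G (p @ [e])" "p \<noteq> []"
  shows "leftmost_derivation G (sentential_form p) (expansions G [e]) (sentential_form (p @ [e]))"
proof -
  from assms have p: "path G p" and step: "path_step G p e" by (simp_all add: path_snoc_iff)
  from step show ?thesis
  proof cases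
    case (prediction i k X \<xi> Y \<mu> r \<nu>)
    have r: "r < length p" using path_last(1)[OF p prediction(2)] .
    \<comment> \<open>The new root index is \<open>length p\<close>, so \<open>pending\<close> reads
      the predicting state, the last of \<open>p\<close>, and \<open>tl\<close> drops the
      nonterminal being expanded.\<close>
    have "pending (p @ [e]) (length p) = \<mu> @ pending p r"
      using r prediction(2) assms(2) pending_append[of r p "[e]"]
      by (subst pending.simps) (auto simp: nth_append last_conv_nth)
    then show ?thesis
      using prediction by (auto simp: sentential_form_def)
  next
    case (scanning i k X \<xi> a \<mu> r)
    have r: "r < length p" using path_last(1)[OF p scanning(2)] .
    then show ?thesis
      using scanning pending_append[of r p "[e]"] by (auto simp: sentential_form_def)
  next
    case (completion i j Y \<nu> r k X \<xi> \<mu> r')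
    have r: "r < length p" using path_last(1)[OF p completion(2)] .
    \<comment> \<open>This bound makes the test in \<open>pending\<close> succeed.\<close>
    have "r' \<le> r - 1"
      using path_nth(1)[OF p _ completion(4)] r by auto
    then have "pending p r = \<mu> @ pending p r'" "r' \<le> length p"
      using r completion by (subst pending.simps, auto)
    then show ?thesis
      using completion pending_append[of r' p "[e]"] by (auto simp: sentential_form_def)
  qed
qed

lemma sentential_form_append:
  assumes "path G (p @ q)" "p \<noteq> []"
  shows "leftmost_derivation G (sentential_form p) (expansions G q) (sentential_form (p @ q))"
  using assms(1)
proof (induction q rule: rev_induct)
  case (snoc e q)
  then have "path G (p @ q)" using path_appendD[of G "p @ q" "[e]"] assms(2) by simp
  moreover have "leftmost_derivation G (sentential_form (p @ q)) (expansions G [e])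
      (sentential_form (p @ q @ [e]))"
    using sentential_form_step[of G "p @ q" e] snoc.prems assms(2) by simp
  ultimately show ?case
    using snoc.IH unfolding expansions_append leftmost_derivation_append_iff by blast
qed simp

text \<open>The nonterminal from which the derivation recorded by a path with first state
  \<open>s\<close> starts. A predicted first state counts its own production, so the derivation
  begins with its left-hand side.\<close>

definition root :: "('n, 't) scfg \<Rightarrow> ('n, 't) state \<Rightarrow> 'n" where
  "root G s = (case lhs s of None \<Rightarrow> start G | Some X \<Rightarrow> X)"

lemma root_simps [simp]: "root G (initial_state G) = start G" "root G (State i k (Some X) \<xi> \<mu>) = X"
  by (simp_all add: root_def initial_state_def)

lemma sentential_form_start:
  assumes "s = initial_state G \<or> predicted_state G s"
  shows "leftmost_derivation G [NT (root G s)] (expansions G [(s, 0)]) (sentential_form [(s, 0)])"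
  using assms
proof
  assume "s = initial_state G"
  then show ?thesis by (simp add: initial_state_def sentential_form_def root_def)
next
  assume "predicted_state G s"
  then show ?thesis by (auto simp: predicted_state_def sentential_form_def root_def)
qed

lemma path_hd:
  assumes "path G p"
  obtains s q where "p = (s, 0) # q" "s = initial_state G \<or> predicted_state G s"
proof -
  obtain e q where p: "p = e # q" using path_not_Nil[OF assms] by (cases p) auto
  then have "path G [e]" using path_appendD[of G "[e]" q] assms by simp
  with p that show thesis by (cases e) auto
qed

lemma sentential_form_path:
  assumes "path G p"
  shows "leftmost_derivation G [NT (root G (fst (hd p)))] (expansions G p) (sentential_form p)"
proof -
  obtain s q where p: "p = (s, 0) # q" "s = initial_state G \<or> predicted_state G s"
    using path_hd[OF assms] .
  have "leftmost_derivation G (sentential_form [(s, 0)]) (expansions G q) (sentential_form p)"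
    using sentential_form_append[of G "[(s, 0)]" q] assms p by simp
  with sentential_form_start[OF p(2)] expansions_append[of G "[(s, 0)]" q] p(1) show ?thesis
    by (auto simp: leftmost_derivation_append_iff)
qed

text \<open>What follows the dot decides the kind of step. Scanning and completion are then forced,
  so different steps predict different productions.\<close>

lemma path_step_deterministic:
  assumes "path_step G p e" "path_step G p e'" "e \<noteq> e'"
  shows "expansions G [e] \<parallel> expansions G [e']"
  using assms by (auto elim!: path_step.cases simp: not_equal_is_parallel)

text \<open>Two paths from the same state can only diverge by predicting different productions.\<close>

lemma parallel_expansions:
  assumes "path G p" "path G q" "hd p = hd q" "p \<parallel> q"
  shows "expansions G p \<parallel> expansions G q"
proof -
  obtain c e p' e' q' where pq: "e \<noteq> e'" "p = c @ e # p'" "q = c @ e' # q'"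
    using parallel_decomp[OF assms(4)] by blast
  then have c: "c \<noteq> []" using assms(3) by (cases c) auto
  have "path G (c @ [e])" "path G (c @ [e'])"
    using assms(1,2) path_appendD[of G "c @ [e]" p'] path_appendD[of G "c @ [e']" q'] pq by simp_all
  then have "expansions G [e] \<parallel> expansions G [e']"
    using path_step_deterministic[of G c e e'] pq(1) c by (simp add: path_snoc_iff)
  then have "expansions G [e] @ expansions G p' \<parallel> expansions G [e'] @ expansions G q'"
    by (rule parallel_append)
  then show ?thesis
    using pq expansions_append[of G "[e]" p'] expansions_append[of G "[e']" q']
    by (auto simp: parallel_def)
qed

text \<open>Root index 0 means that no state is waiting: the rule of the first state itself has been
  worked off.\<close>

definition finished :: "('n, 't) path \<Rightarrow> bool" where
  "finished p \<longleftrightarrow> after (fst (last p)) = [] \<and> snd (last p) = 0"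

lemma sentential_form_finished: "finished p \<Longrightarrow> sentential_form p = map T (generated_string p)"
  by (simp add: finished_def sentential_form_def)

text \<open>Nothing is left to predict or scan, and completion demands a positive root
  index.\<close>

lemma finished_no_step: "finished p \<Longrightarrow> \<not> path_step G p e"
  by (auto simp: finished_def elim!: path_step.cases)

lemma finished_prefix:
  assumes "finished p" "path G q" "path G p" "prefix p q"
  shows "p = q"
proof -
  obtain r where q: "q = p @ r" using assms(4) by (auto elim: prefixE)
  show ?thesis
  proof (cases r)
    case (Cons e r')
    then have "path G (p @ [e])"
      using assms(2) q path_appendD[of G "p @ [e]" r'] by simp
    with finished_no_step[OF assms(1)] path_not_Nil[OF assms(3)] show ?thesis
      by (simp add: path_snoc_iff)
  qed (use q in simp)
qed

text \<open>
  Scanning and completion leave the sentential form unchanged. They terminate, as scanning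
  shortens the unprocessed part of the form and completion decreases the root index.
\<close>

lemma path_advance:
  assumes "path G p"
  shows "\<exists>q. path G (p @ q) \<and> expansions G q = [] \<and>
    (finished (p @ q) \<or> (\<exists>Y \<mu>. after (fst (last (p @ q))) = NT Y # \<mu>))"
  using assms
proof (induction "length (after (fst (last p)) @ pending p (snd (last p))) + snd (last p)"
    arbitrary: p rule: less_induct)
  case less
  have ne: "p \<noteq> []" using less.prems by (rule path_not_Nil)
  obtain i k X \<xi> \<mu> r where last: "last p = (State i k X \<xi> \<mu>, r)"
    by (metis state.exhaust surj_pair)
  have r: "r < length p" using path_last(1)[OF less.prems last] .
  let ?m = "\<lambda>p. length (after (fst (last p)) @ pending p (snd (last p))) + snd (last p)"
  have step: ?case if "path_step G p e" "expansions G [e] = []" "?m (p @ [e]) < ?m p" for e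
  proof -
    from that less.prems ne have "path G (p @ [e])" by (simp add: path_snoc_iff)
    from less.hyps[OF that(3) this] obtain q where "path G (p @ (e # q))" "expansions G q = []"
      "finished (p @ (e # q)) \<or> (\<exists>Y \<mu>. after (fst (last (p @ (e # q)))) = NT Y # \<mu>)"
      by auto
    with that(2) expansions_append[of G "[e]" q] show ?thesis by (intro exI[of _ "e # q"]) simp
  qed
  show ?case
  proof (cases \<mu>)
    case Nil
    show ?thesis
    proof (cases "r = 0")
      case True
      with Nil last less.prems show ?thesis
        by (intro exI[of _ "[]"]) (simp add: finished_def)
    next
      case False
      with path_last(3)[OF less.prems last] obtain Y k' X' \<xi>' \<mu>' r' where
        *: "X = Some Y" "p ! (r - 1) = (State k k' X' \<xi>' (NT Y # \<mu>'), r')"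
        by auto
      have "r' \<le> r - 1" using path_nth(1)[OF less.prems _ *(2)] r by auto
      then have "pending p r = \<mu>' @ pending p r'" "r' < r"
        using False * by (subst pending.simps, auto)
      with False * last Nil r show ?thesis
        by (intro step[OF path_step.completion]) (auto simp: pending_append)
    qed
  next
    case (Cons a \<mu>')
    show ?thesis
    proof (cases a)
      case (NT Y)
      with Cons last less.prems show ?thesis by (intro exI[of _ "[]"]) simp
    next
      case (T c)
      with Cons last r show ?thesis
        by (intro step[OF path_step.scanning]) (auto simp: pending_append)
    qed
  qed
qed

text \<open>As the form contains a nonterminal, the run cannot finish and stops before a
  nonterminal. Only letters precede this one in the form, so it is the leftmost, namely
  \<open>Y\<close>.\<close>

lemma path_advance_NT:
  assumes p: "path G p" and form: "sentential_form p = map T u @ NT Y # \<mu>"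
  shows "\<exists>q i k X \<xi> \<mu>' r. path G (p @ q) \<and> expansions G q = [] \<and> generated_string (p @ q) = u \<and>
    sentential_form (p @ q) = sentential_form p \<and> last (p @ q) = (State i k X \<xi> (NT Y # \<mu>'), r)"
proof -
  obtain q where q: "path G (p @ q)" "expansions G q = []"
    "finished (p @ q) \<or> (\<exists>Y \<mu>. after (fst (last (p @ q))) = NT Y # \<mu>)"
    using path_advance[OF p] by blast
  have form': "sentential_form (p @ q) = map T u @ NT Y # \<mu>"
    using sentential_form_append[OF q(1) path_not_Nil[OF p]] q(2) form by simp
  then have "\<not> finished (p @ q)" by (metis sentential_form_finished map_T_neq_NT(1))
  with q(3) obtain i k X \<xi> Y' \<mu>' r where last: "last (p @ q) = (State i k X \<xi> (NT Y' # \<mu>'), r)"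
    by (metis fst_conv state.exhaust_sel surj_pair)
  with form' have "map T (generated_string (p @ q)) @ NT Y' # \<mu>' @ pending (p @ q) r = map T u @ NT Y # \<mu>"
    unfolding sentential_form_def by simp
  then have "generated_string (p @ q) = u" "Y' = Y"
    unfolding map_T_NT_eq_iff by simp_all
  with q form form' last show ?thesis by metis
qed

text \<open>Converse to \<open>sentential_form_append\<close>: for each production in turn, the path
  scans and completes until the leftmost nonterminal stands after the dot, and then
  predicts.\<close>

lemma path_extend:
  assumes "leftmost_derivation G (sentential_form p) rs \<psi>" "path G p"
  shows "\<exists>q. path G (p @ q) \<and> expansions G q = rs \<and> sentential_form (p @ q) = \<psi>"
  using assms
proof (induction rs arbitrary: p)
  case Nil
  then show ?case by (intro exI[of _ "[]"]) simp
next
  case (Cons r rs)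
  have ne: "p \<noteq> []" using Cons.prems(2) by (rule path_not_Nil)
  obtain Y \<nu> where r: "r = (Y, \<nu>)" by fastforce
  with Cons.prems(1) obtain u \<mu> where
    Y: "(Y, \<nu>) \<in> prods G" "sentential_form p = map T u @ NT Y # \<mu>"
      "leftmost_derivation G (map T u @ \<nu> @ \<mu>) rs \<psi>"
    by (auto simp: leftmost_derivation_Cons_iff)
  obtain q i k X \<xi> \<mu>' r' where q: "path G (p @ q)" "expansions G q = []"
    "sentential_form (p @ q) = sentential_form p" "last (p @ q) = (State i k X \<xi> (NT Y # \<mu>'), r')"
    using path_advance_NT[OF Cons.prems(2) Y(2)] by blast
  define e where "e = (State i i (Some Y) [] \<nu> :: ('a, 'b) state, length (p @ q))"
  have e: "path G ((p @ q) @ [e])" "expansions G [e] = [(Y, \<nu>)]"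
    using path_step.prediction[OF q(4) Y(1)] q(1) ne Y(1)
    by (simp_all add: path_snoc_iff e_def del: append_assoc)
  have "sentential_form ((p @ q) @ [e]) = map T u @ \<nu> @ \<mu>"
    using sentential_form_step[OF e(1)] ne e(2) q(3) Y(2) by simp
  with Cons.IH[OF _ e(1)] Y(3) obtain q' where
    "path G (((p @ q) @ [e]) @ q')" "expansions G q' = rs"
    "sentential_form (((p @ q) @ [e]) @ q') = \<psi>"
    by auto
  with e(2) q(2) r expansions_append[of G "[e]" q'] show ?case
    by (intro exI[of _ "q @ [e] @ q'"]) simp
qed

text \<open>After the last production the outstanding scans and completions are appended. Stopping
  before a nonterminal would leave it in a form that is a word, so the run finishes.\<close>

lemma path_extend_finished:
  assumes "leftmost_derivation G (sentential_form p) rs (map T w)" "path G p"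
  shows "\<exists>q. path G (p @ q) \<and> expansions G q = rs \<and> finished (p @ q) \<and> generated_string (p @ q) = w"
proof -
  obtain q where q: "path G (p @ q)" "expansions G q = rs" "sentential_form (p @ q) = map T w"
    using path_extend[OF assms] by blast
  obtain q' where q': "path G ((p @ q) @ q')" "expansions G q' = []"
    "finished ((p @ q) @ q') \<or> (\<exists>Y \<mu>. after (fst (last ((p @ q) @ q'))) = NT Y # \<mu>)"
    using path_advance[OF q(1)] by blast
  have form: "sentential_form ((p @ q) @ q') = map T w"
    using sentential_form_append[OF q'(1) path_not_Nil[OF q(1)]] q'(2) q(3) by simp
  moreover have "after (fst (last ((p @ q) @ q'))) \<noteq> NT Y # \<mu>" for Y \<mu>
    using form unfolding sentential_form_def by (metis map_T_neq_NT(2) append_Cons)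
  ultimately have fin: "finished ((p @ q) @ q')" using q'(3) by blast
  have "generated_string ((p @ q) @ q') = w"
    using form sentential_form_finished[OF fin] map_T_eq_iff by metis
  with q q' fin show ?thesis by (intro exI[of _ "q @ q'"]) simp
qed


section \<open>The chart\<close>

text \<open>Once the dot has moved, \<open>k < i\<close> holds because scanning advances the
  position and completion in the chart demands \<open>j < i\<close>. This bound justifies completion
  in \<open>path_in_chart\<close>.\<close>

lemma chart_state:
  assumes "State i k X \<xi> \<mu> \<in> chart G x"
  shows "k \<le> i" "i \<le> length x" "\<xi> \<noteq> [] \<Longrightarrow> k < i"
    "case X of None \<Rightarrow> \<xi> @ \<mu> = [NT (start G)] | Some Y \<Rightarrow> (Y, \<xi> @ \<mu>) \<in> prods G"
proof -
  have "k \<le> i \<and> i \<le> length x \<and> (\<xi> \<noteq> [] \<longrightarrow> k < i) \<and>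
    (case X of None \<Rightarrow> \<xi> @ \<mu> = [NT (start G)] | Some Y \<Rightarrow> (Y, \<xi> @ \<mu>) \<in> prods G)"
    using assms
    by (induction "State i k X \<xi> \<mu>" arbitrary: i k X \<xi> \<mu> rule: chart.induct)
      (auto simp: initial_state_def split: option.splits)
  then show "k \<le> i" "i \<le> length x" "\<xi> \<noteq> [] \<Longrightarrow> k < i"
    "case X of None \<Rightarrow> \<xi> @ \<mu> = [NT (start G)] | Some Y \<Rightarrow> (Y, \<xi> @ \<mu>) \<in> prods G"
    by blast+
qed

text \<open>A chart state is given by two positions up to \<open>length x\<close>, a production or
  the dummy one, and the place of the dot.\<close>

lemma finite_chart:
  assumes "is_scfg G"
  shows "finite (chart G x)"
proof (rule finite_subset)
  let ?R = "insert (None, [NT (start G)]) ((\<lambda>(X, \<nu>). (Some X, \<nu>)) ` prods G)"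
  let ?f = "\<lambda>(i, k, (X, \<nu>), n). State i k X (take n \<nu>) (drop n \<nu>)"
  show "chart G x \<subseteq> ?f ` ({..length x} \<times> {..length x} \<times> (SIGMA r:?R. {..length (snd r)}))"
  proof
    fix s assume s: "s \<in> chart G x"
    obtain i k X \<xi> \<mu> where s_eq: "s = State i k X \<xi> \<mu>" by (cases s)
    note * = chart_state[OF s[unfolded s_eq]]
    have "(X, \<xi> @ \<mu>) \<in> ?R" using *(4) by (force split: option.splits)
    then show "s \<in> ?f ` ({..length x} \<times> {..length x} \<times> (SIGMA r:?R. {..length (snd r)}))"
      using *(1,2) by (intro image_eqI[of _ _ "(i, k, (X, \<xi> @ \<mu>), length \<xi>)"]) (auto simp: s_eq)
  qed
  show "finite (?f ` ({..length x} \<times> {..length x} \<times> (SIGMA r:?R. {..length (snd r)})))"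
    using assms by (intro finite_imageI finite_cartesian_product finite_SigmaI) (auto simp: is_scfg_def)
qed

text \<open>Path steps mirror the chart rules up to side conditions. That the scanned letter is
  \<open>x ! i\<close> follows from the prefix hypothesis; that a completed state has
  \<open>j < i\<close> follows from the absence of null productions.\<close>

lemma path_in_chart:
  assumes "path G p" "fst (hd p) \<in> chart G x" "no_null_productions G"
    and "prefix (generated_string p) (drop (origin (fst (hd p))) x)"
  shows "fst ` set p \<subseteq> chart G x"
  using assms
proof (induction rule: path_induct)
  case (start s)
  then show ?case by simp
next
  case (step p e)
  have ne: "p \<noteq> []" using step(1) by (rule path_not_Nil)
  have "prefix (generated_string p) (drop (origin (fst (hd p))) x)"
    using step.prems(3) append_prefixD ne by fastforce
  with step ne have IH: "fst ` set p \<subseteq> chart G x" by simp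
  then have last: "fst (last p) \<in> chart G x" using ne by auto
  from step(2) have "fst e \<in> chart G x"
  proof cases
    case (prediction i k X \<xi> Y \<mu> r \<nu>)
    with last show ?thesis by (auto intro: chart.prediction)
  next
    case (scanning i k X \<xi> a \<mu> r)
    obtain z where "drop (origin (fst (hd p))) x = generated_string p @ a # z"
      using step.prems(3) scanning(1) ne by (auto elim: prefixE)
    moreover have "i = origin (fst (hd p)) + length (generated_string p)"
      using path_pos[OF step(1)] scanning(2) by simp
    ultimately have "drop i x = a # z"
      by (metis add.commute append_eq_conv_conj drop_drop)
    then have i: "i < length x" "a = x ! i"
      by (metis drop_eq_Nil linorder_not_le list.distinct(1))
        (metis \<open>drop i x = a # z\<close> hd_drop_conv_nth list.sel(1) drop_eq_Nil linorder_not_le list.distinct(1))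
    have "State i k X \<xi> (T a # \<mu>) \<in> chart G x" using last scanning(2) by simp
    from chart.scanning[OF this i] show ?thesis unfolding scanning(1) fst_conv .
  next
    case (completion i j Y \<nu> r k X \<xi> \<mu> r')
    have r: "r < length p" using path_last(1)[OF step(1) completion(2)] .
    have "(Y, \<nu>) \<in> prods G" using path_last(4)[OF step(1) completion(2)] by simp
    then have "\<nu> \<noteq> []" using assms(3) by (auto simp: no_null_productions_def)
    then have "j < i" using last completion(2) chart_state(3)[of i j "Some Y" \<nu> "[]" G x] by simp
    moreover have "p ! (r - 1) \<in> set p" using r by simp
    ultimately show ?thesis
      using last completion IH chart.completion[of i j Y \<nu> G x k X \<xi> \<mu>] by force
  qed
  with IH show ?case by auto
qed


section \<open>String probabilities as sums over paths\<close>

text \<open>\<open>expansions\<close> is a bijection from these paths onto the leftmost derivations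
  of \<open>w\<close>. Different first states are told apart by \<open>parallel\<close>;
  surjectivity comes from \<open>cover\<close> and \<open>path_extend_finished\<close>. The set
  \<open>S\<close> covers both uses: the initial state alone, and all predicted states of one
  nonterminal.\<close>

lemma string_prob_paths:
  assumes S: "\<And>s. s \<in> S \<Longrightarrow> (s = initial_state G \<or> predicted_state G s) \<and> root G s = X"
    and parallel: "\<And>s s'. s \<in> S \<Longrightarrow> s' \<in> S \<Longrightarrow> s \<noteq> s' \<Longrightarrow>
      expansions G [(s, 0)] \<parallel> expansions G [(s', 0)]"
    and cover: "\<And>rs. leftmost_derivation G [NT X] rs (map T w) \<Longrightarrow>
      \<exists>s\<in>S. \<exists>rs'. rs = expansions G [(s, 0)] @ rs'"
  shows "string_prob G X w =
    (\<Sum>\<^sub>\<infinity>p\<in>{p. path G p \<and> fst (hd p) \<in> S \<and> finished p \<and> generated_string p = w}.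
       ennreal (path_prob G p))"
proof -
  let ?A = "{p. path G p \<and> fst (hd p) \<in> S \<and> finished p \<and> generated_string p = w}"
  have "inj_on (expansions G) ?A"
  proof (rule inj_onI, clarify)
    fix p q
    assume p: "path G p" "fst (hd p) \<in> S" "finished p"
      and q: "path G q" "fst (hd q) \<in> S" "finished q"
      and eq: "expansions G p = expansions G q"
    obtain s p' where p_eq: "p = (s, 0) # p'" using path_hd[OF p(1)] by metis
    obtain s' q' where q_eq: "q = (s', 0) # q'" using path_hd[OF q(1)] by metis
    have "s = s'"
    proof (rule ccontr)
      assume "s \<noteq> s'"
      with p(2) q(2) p_eq q_eq have "expansions G [(s, 0)] \<parallel> expansions G [(s', 0)]"
        by (intro parallel) simp_all
      then have "expansions G p \<parallel> expansions G q"
        using parallel_append expansions_append[of G "[(s, 0)]" p'] expansions_append[of G "[(s', 0)]" q']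
        by (simp add: p_eq q_eq)
      with eq show False by (simp add: parallel_def)
    qed
    with p_eq q_eq have "hd p = hd q" by simp
    \<comment> \<open>Equal lists make the paths comparable as prefixes, and a finished path has no
      proper extension.\<close>
    with parallel_expansions[OF p(1) q(1)] eq have "\<not> p \<parallel> q" by (auto simp: parallel_def)
    then show "p = q"
      using finished_prefix p q by (metis parallel_def)
  qed
  moreover have "expansions G ` ?A = {rs. leftmost_derivation G [NT X] rs (map T w)}"
  proof (intro equalityI subsetI)
    fix rs assume "rs \<in> expansions G ` ?A"
    then obtain p where "path G p" "fst (hd p) \<in> S" "finished p" "generated_string p = w"
      "rs = expansions G p"
      by blast
    with sentential_form_path[of G p] S show "rs \<in> {rs. leftmost_derivation G [NT X] rs (map T w)}"
      by (simp add: sentential_form_finished)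
  next
    fix rs assume "rs \<in> {rs. leftmost_derivation G [NT X] rs (map T w)}"
    then have rs: "leftmost_derivation G [NT X] rs (map T w)" by simp
    then obtain s rs' where s: "s \<in> S" "rs = expansions G [(s, 0)] @ rs'" using cover by blast
    from s(1) have "leftmost_derivation G [NT X] (expansions G [(s, 0)]) (sentential_form [(s, 0)])"
      using S sentential_form_start by blast
    with rs s(2) have "leftmost_derivation G (sentential_form [(s, 0)]) rs' (map T w)"
      by (auto simp: leftmost_derivation_append_iff dest: leftmost_derivation_functional)
    moreover have "path G [(s, 0)]" using S[OF s(1)] by simp
    ultimately obtain q where "path G ([(s, 0)] @ q)" "expansions G q = rs'"
      "finished ([(s, 0)] @ q)" "generated_string ([(s, 0)] @ q) = w"
      using path_extend_finished by blast
    with s expansions_append[of G "[(s, 0)]" q] show "rs \<in> expansions G ` ?A"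
      by (intro image_eqI[of _ _ "[(s, 0)] @ q"]) simp_all
  qed
  ultimately have "bij_betw (expansions G) ?A {rs. leftmost_derivation G [NT X] rs (map T w)}"
    by (simp add: bij_betw_def)
  from infsum_reindex_bij_betw[OF this, of "\<lambda>rs. ennreal (derivation_prob G rs)"] show ?thesis
    by (simp add: string_prob_def path_prob_eq)
qed

text \<open>The start position \<open>k\<close> is arbitrary, since a path may begin with a
  predicted state at any position. As \<open>[NT X]\<close> is not a word, each derivation begins
  with a production of \<open>X\<close>, which selects the first state.\<close>

lemma string_prob_predicted_paths:
  "string_prob G X w =
    (\<Sum>\<^sub>\<infinity>p\<in>{p. path G p \<and> (\<exists>\<nu>. (X, \<nu>) \<in> prods G \<and> fst (hd p) = State k k (Some X) [] \<nu>) \<and>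
        finished p \<and> generated_string p = w}. ennreal (path_prob G p))"
proof -
  let ?S = "{State k k (Some X) [] \<nu> | \<nu>. (X, \<nu>) \<in> prods G}"
  have "string_prob G X w =
    (\<Sum>\<^sub>\<infinity>p\<in>{p. path G p \<and> fst (hd p) \<in> ?S \<and> finished p \<and> generated_string p = w}.
       ennreal (path_prob G p))"
  proof (rule string_prob_paths)
    fix rs assume rs: "leftmost_derivation G [NT X] rs (map T w)"
    then obtain r rs' where "rs = r # rs'" using map_T_neq_NT(2)[of "[]" X "[]" w] by (cases rs) auto
    with rs obtain \<nu> where "(X, \<nu>) \<in> prods G" "rs = (X, \<nu>) # rs'" by (cases r) auto
    then show "\<exists>s\<in>?S. \<exists>rs'. rs = expansions G [(s, 0)] @ rs'" by force
  qed (auto simp: predicted_state_def not_equal_is_parallel)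
  also have "{p. path G p \<and> fst (hd p) \<in> ?S \<and> finished p \<and> generated_string p = w} =
    {p. path G p \<and> (\<exists>\<nu>. (X, \<nu>) \<in> prods G \<and> fst (hd p) = State k k (Some X) [] \<nu>) \<and>
        finished p \<and> generated_string p = w}"
    by blast
  finally show ?thesis .
qed

lemma string_prob_initial_paths:
  "string_prob G (start G) w =
    (\<Sum>\<^sub>\<infinity>p\<in>{p. path G p \<and> fst (hd p) = initial_state G \<and> finished p \<and> generated_string p = w}.
       ennreal (path_prob G p))"
proof -
  have "expansions G [(initial_state G, 0)] = []" by (simp add: initial_state_def)
  then show ?thesis using string_prob_paths[of "{initial_state G}" G "start G" w] by simp
qed


section \<open>Inner and forward probabilities of complete states\<close>

lemma finished_state:
  assumes "path G p" "finished p" "fst (hd p) = State k k X [] \<nu>"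
  shows "last p = (State (k + length (generated_string p)) k X \<nu> [], 0)"
proof -
  obtain i k' X' \<xi> where last: "last p = (State i k' X' \<xi> [], 0)"
    using assms(2) unfolding finished_def by (metis prod.collapse state.exhaust_sel)
  with path_last(2)[OF assms(1) last] path_pos[OF assms(1)] assms(3) show ?thesis by simp
qed

text \<open>The derivation is run as a path from the initial state until \<open>NT X\<close> stands
  after the dot. Exactly \<open>take k x\<close> is scanned by then, so the path stays in the chart
  and is at position \<open>k\<close>, where the chart predicts \<open>X\<close>.\<close>

lemma predicted_in_chart:
  assumes G: "no_null_productions G"
    and deriv: "leftmost_derivation G [NT (start G)] rs (map T (take k x) @ NT X # \<phi>)"
    and k: "k \<le> length x" and X: "(X, \<nu>) \<in> prods G"
  shows "State k k (Some X) [] \<nu> \<in> chart G x"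
proof -
  let ?p = "[(initial_state G, 0)]"
  have p: "path G ?p" by simp
  have "sentential_form ?p = [NT (start G)]" by (simp add: sentential_form_def initial_state_def)
  with deriv obtain q where q: "path G (?p @ q)"
    "sentential_form (?p @ q) = map T (take k x) @ NT X # \<phi>"
    using path_extend[OF _ p] by metis
  obtain q' i k' X' \<xi> \<mu> r where q': "path G ((?p @ q) @ q')"
    "generated_string ((?p @ q) @ q') = take k x" "last ((?p @ q) @ q') = (State i k' X' \<xi> (NT X # \<mu>), r)"
    using path_advance_NT[OF q] by blast
  have hd: "fst (hd ((?p @ q) @ q')) = initial_state G" by simp
  have "fst ` set ((?p @ q) @ q') \<subseteq> chart G x"
    using q'(1)
  proof (rule path_in_chart)
    show "prefix (generated_string ((?p @ q) @ q')) (drop (origin (fst (hd ((?p @ q) @ q')))) x)"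
      unfolding q'(2) hd by (simp add: initial_state_def take_is_prefix)
    show "fst (hd ((?p @ q) @ q')) \<in> chart G x" unfolding hd by (rule chart.init)
  qed (rule G)
  moreover have "last ((?p @ q) @ q') \<in> set ((?p @ q) @ q')" by (rule last_in_set) simp
  ultimately have "State i k' X' \<xi> (NT X # \<mu>) \<in> chart G x" unfolding q'(3) by force
  moreover have "i = k"
    using path_pos[OF q'(1)] unfolding hd q'(2,3) using k by (simp add: initial_state_def)
  ultimately show ?thesis using X by (blast intro: chart.prediction)
qed

text \<open>The finished paths for \<open>X\<close> are sorted by their last state. The derivation
  \<open>rs\<close> puts their first states, and hence their last states, into the chart.\<close>

lemma string_prob_inner_prob:
  assumes G: "is_scfg G" "no_null_productions G"
    and ki: "k < i" "i \<le> length x"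
    and deriv: "leftmost_derivation G [NT (start G)] rs (map T (substring x 0 k) @ NT X # \<phi>)"
  shows "string_prob G X (substring x k i) =
    (\<Sum>s | s \<in> chart G x \<and> complete_state s \<and> pos s = i \<and> lhs s = Some X \<and> origin s = k.
       inner_prob G x s)"
proof -
  let ?C = "{s \<in> chart G x. complete_state s \<and> pos s = i \<and> lhs s = Some X \<and> origin s = k}"
  let ?P = "{p. path G p \<and> (\<exists>\<nu>. (X, \<nu>) \<in> prods G \<and> fst (hd p) = State k k (Some X) [] \<nu>) \<and>
        finished p \<and> generated_string p = substring x k i}"
  have len: "length (substring x k i) = i - k" using ki by (simp add: substring_def)
  have "?P = (\<Union>s\<in>?C. inner_paths G x s)"
  proof (intro equalityI subsetI)
    fix p assume "p \<in> ?P"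
    then obtain \<nu> where p: "path G p" "finished p" "generated_string p = substring x k i"
      and \<nu>: "(X, \<nu>) \<in> prods G" "fst (hd p) = State k k (Some X) [] \<nu>"
      by blast
    let ?s = "State i k (Some X) \<nu> []"
    have last: "last p = (?s, 0)"
      using finished_state[OF p(1,2) \<nu>(2)] p(3) ki len by simp
    have "State k k (Some X) [] \<nu> \<in> chart G x"
      using deriv ki \<nu>(1) by (intro predicted_in_chart[OF G(2)]) (auto simp: substring_def)
    then have "fst ` set p \<subseteq> chart G x"
      using p(1,3) \<nu>(2) G(2) by (intro path_in_chart) (auto simp: substring_def take_is_prefix)
    moreover have "last p \<in> set p" using path_not_Nil[OF p(1)] by simp
    ultimately have "?s \<in> chart G x" using last by force
    moreover have "p \<in> inner_paths G x ?s"
      using p \<nu> last len by (simp add: inner_paths_def path_length_eq)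
    ultimately show "p \<in> (\<Union>s\<in>?C. inner_paths G x s)"
      by (intro UN_I[of ?s]) (simp_all add: complete_state_def)
  next
    fix p assume "p \<in> (\<Union>s\<in>?C. inner_paths G x s)"
    then obtain s where s: "s \<in> ?C" "p \<in> inner_paths G x s" by blast
    then obtain \<nu> where s_eq: "s = State i k (Some X) \<nu> []"
      by (cases s) (auto simp: complete_state_def)
    with s have "(X, \<nu>) \<in> prods G" using chart_state(4)[of i k "Some X" \<nu> "[]" G x] by simp
    with s s_eq show "p \<in> ?P" by (simp add: inner_paths_def finished_def)
  qed
  moreover have "disjoint_family_on (inner_paths G x) ?C"
    by (auto simp: disjoint_family_on_def inner_paths_def)
  moreover have "finite ?C" using finite_chart[OF G(1)] by simp
  ultimately show ?thesis
    by (simp add: string_prob_predicted_paths[of G X _ k] infsum_finite_UN_ennreal inner_prob_def)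
qed

lemma inner_paths_final_state:
  "inner_paths G x (final_state G (length x)) =
    {p. path G p \<and> fst (hd p) = initial_state G \<and> finished p \<and> generated_string p = x}"
    (is "?I = ?P")
proof (intro equalityI subsetI)
  fix p assume "p \<in> ?P"
  then show "p \<in> ?I"
    using finished_state[of G p 0 None "[NT (start G)]"]
    by (auto simp: inner_paths_def final_state_def initial_state_def path_length_eq substring_def)
qed (auto simp: inner_paths_def final_state_def initial_state_def substring_def finished_def)

lemma forward_paths_final_state:
  "forward_paths G x (final_state G (length x)) = inner_paths G x (final_state G (length x))"
proof -
  \<comment> \<open>By \<open>path_last\<close> a positive root index forces a nonterminal on the
    left, so a dummy state has root index 0, as inner paths demand.\<close>
  have "last p = (final_state G i, 0)" if "path G p" "fst (last p) = final_state G i" for p i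
    using that path_last(3)[of G p i 0 None "[NT (start G)]" "[]" "snd (last p)"]
    by (cases "last p") (auto simp: final_state_def)
  note last = this
  show ?thesis
  proof (intro equalityI subsetI)
    fix p assume p: "p \<in> forward_paths G x (final_state G (length x))"
    then have "last p = (final_state G (length x), 0)"
      using last by (simp add: forward_paths_def)
    with p show "p \<in> inner_paths G x (final_state G (length x))"
      by (simp add: forward_paths_def inner_paths_def final_state_def initial_state_def)
  qed (simp add: forward_paths_def inner_paths_def final_state_def initial_state_def)
qed


section \<open>Prefix probabilities\<close>

text \<open>The paths that stop right after scanning the last letter of a nonempty \<open>x\<close>;
  they are the first halves of the cut derivations.\<close>

definition scanning_paths :: "('n, 't) scfg \<Rightarrow> 't list \<Rightarrow> ('n, 't) path set" where
  "scanning_paths G x = {p. path G p \<and> fst (hd p) = initial_state G \<and>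
     scanned_state (fst (last p)) \<and> generated_string p = x}"

text \<open>States are removed from the end until the last one is that which scans the last letter
  of \<open>x\<close>.\<close>

lemma generated_string_split:
  assumes "generated_string p = x @ y" "x \<noteq> []"
  shows "\<exists>q r. p = q @ r \<and> q \<noteq> [] \<and> scanned_state (fst (last q)) \<and> generated_string q = x"
  using assms
proof (induction p arbitrary: y rule: rev_induct)
  case (snoc e p)
  obtain s r where e: "e = (s, r)" by fastforce
  show ?case
  proof (cases "scanned_state s \<and> y = []")
    case True
    with e snoc.prems show ?thesis by (intro exI[of _ "p @ [e]"] exI[of _ "[]"]) simp
  next
    case False
    have "\<exists>y'. generated_string p = x @ y'"
    proof (cases "scanned_state s")
      case True
      then obtain a where "generated_string [e] = [a]" by (simp add: generated_string_def e)
      \<comment> \<open>Here \<open>y\<close> is nonempty and loses its last letter, the one scanned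
        by the removed state.\<close>
      with snoc.prems(1) True False show ?thesis by (cases y rule: rev_cases) auto
    next
      case False
      with snoc.prems(1) e show ?thesis by (intro exI[of _ y]) simp
    qed
    with snoc.IH snoc.prems(2) obtain q r' where
      "p = q @ r'" "q \<noteq> []" "scanned_state (fst (last q))" "generated_string q = x"
      by blast
    then show ?thesis by (intro exI[of _ q] exI[of _ "r' @ [e]"]) simp
  qed
qed simp

text \<open>A proper extension ending in a scanned state would have read a further letter.\<close>

lemma scanning_paths_prefix:
  assumes "p \<in> scanning_paths G x" "q \<in> scanning_paths G x" "prefix p q"
  shows "p = q"
proof -
  obtain r where q: "q = p @ r" using assms(3) by (auto elim: prefixE)
  have "generated_string r = []" using assms(1,2) q by (simp add: scanning_paths_def)
  then have "\<forall>(s, t)\<in>set r. \<not> scanned_state s" by (simp add: generated_string_eq_Nil_iff)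
  moreover have "r \<noteq> [] \<Longrightarrow> scanned_state (fst (last r))"
    using assms(2) q by (simp add: scanning_paths_def)
  ultimately have "r = []" using last_in_set[of r] by fastforce
  with q show ?thesis by simp
qed

text \<open>
  A terminating derivation of a word with prefix \<open>x\<close> is cut at the scanning of the last letter of
  \<open>x\<close>: the first part is a path, the second an arbitrary terminating derivation of the remaining
  sentential form.
\<close>

lemma bij_betw_scanning_paths:
  assumes "x \<noteq> []"
  shows "bij_betw (\<lambda>(p, rs). expansions G p @ rs)
    (SIGMA p:scanning_paths G x. terminating G (sentential_form p))
    {rs. \<exists>y. leftmost_derivation G [NT (start G)] rs (map T (x @ y))}"
    (is "bij_betw ?f ?A ?B")
proof -
  have deriv: "leftmost_derivation G [NT (start G)] (expansions G p) (sentential_form p)"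
    if "p \<in> scanning_paths G x" for p
    using sentential_form_path[of G p] that by (simp add: scanning_paths_def)
  have "inj_on ?f ?A"
  proof (rule inj_onI, clarify)
    fix p rs p' rs'
    assume p: "p \<in> scanning_paths G x" "p' \<in> scanning_paths G x"
      and eq: "expansions G p @ rs = expansions G p' @ rs'"
    from p have path: "path G p" "path G p'" by (simp_all add: scanning_paths_def)
    have "hd p = hd p'"
      using path_hd[OF path(1)] path_hd[OF path(2)] p
      by (metis (mono_tags, lifting) scanning_paths_def fst_conv list.sel(1) mem_Collect_eq)
    \<comment> \<open>Two prefixes of the same list are comparable.\<close>
    moreover have "\<not> expansions G p \<parallel> expansions G p'"
      using eq parallel_append by (metis parallel_def prefix_order.refl)
    ultimately have "\<not> p \<parallel> p'" using parallel_expansions[OF path] by blast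
    then have "p = p'" using scanning_paths_prefix p by (metis parallel_def)
    with eq show "p = p' \<and> rs = rs'" by simp
  qed
  moreover have "?f ` ?A = ?B"
  proof (intro equalityI subsetI)
    fix rs assume "rs \<in> ?f ` ?A"
    then obtain p rs' z where p: "p \<in> scanning_paths G x" "rs = expansions G p @ rs'"
      "leftmost_derivation G (sentential_form p) rs' (map T z)"
      by (auto simp: terminating_def)
    have path: "path G p" using p(1) by (simp add: scanning_paths_def)
    \<comment> \<open>The remaining derivation extends \<open>p\<close> itself, so its word begins
      with the \<open>x\<close> already scanned.\<close>
    obtain q where "generated_string (p @ q) = z"
      using path_extend_finished[OF p(3) path] by blast
    then have "z = x @ generated_string q"
      using p(1) by (simp add: scanning_paths_def)
    then show "rs \<in> ?B" using deriv[OF p(1)] p(2,3) by (auto simp: leftmost_derivation_append_iff)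
  next
    fix rs assume "rs \<in> ?B"
    then obtain y where y: "leftmost_derivation G [NT (start G)] rs (map T (x @ y))" by blast
    have "sentential_form [(initial_state G, 0)] = [NT (start G)]"
      by (simp add: sentential_form_def initial_state_def)
    with y obtain q where q: "path G ([(initial_state G, 0)] @ q)" "expansions G q = rs"
      "generated_string ([(initial_state G, 0)] @ q) = x @ y"
      using path_extend_finished[of G "[(initial_state G, 0)]" rs "x @ y"] by auto
    obtain p r where p: "[(initial_state G, 0)] @ q = p @ r" "p \<noteq> []"
      "scanned_state (fst (last p))" "generated_string p = x"
      using generated_string_split[OF q(3) assms] by blast
    have path: "path G (p @ r)" using q(1) p(1) by simp
    have "hd p = (initial_state G, 0)" using p(1,2) by (metis append_Cons hd_append2 list.sel(1))
    with p path path_appendD have pS: "p \<in> scanning_paths G x"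
      by (auto simp: scanning_paths_def)
    have "expansions G ([(initial_state G, 0)] @ q) = expansions G q"
      by (simp add: expansions_def initial_state_def predicted_state_def)
    then have rs: "rs = expansions G p @ expansions G r" using q(2) unfolding p(1) by simp
    then obtain \<theta> where \<theta>: "leftmost_derivation G [NT (start G)] (expansions G p) \<theta>"
      "leftmost_derivation G \<theta> (expansions G r) (map T (x @ y))"
      using y unfolding rs leftmost_derivation_append_iff by blast
    then have "\<theta> = sentential_form p" using deriv[OF pS] by (metis leftmost_derivation_functional)
    with \<theta>(2) have "leftmost_derivation G (sentential_form p) (expansions G r) (map T (x @ y))"
      by simp
    then have "expansions G r \<in> terminating G (sentential_form p)"
      unfolding terminating_def by blast
    with rs pS show "rs \<in> ?f ` ?A" by (intro image_eqI[of _ _ "(p, expansions G r)"]) simp_all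
  qed
  ultimately show ?thesis by (simp add: bij_betw_def)
qed

text \<open>The continuation \<open>y\<close> is determined by the derivation and lies over the
  terminals of \<open>G\<close>, so the double sum becomes one sum over derivations.\<close>

lemma prefix_prob_eq_infsum:
  assumes "is_scfg G"
  shows "prefix_prob G x =
    (\<Sum>\<^sub>\<infinity>rs\<in>{rs. \<exists>y. leftmost_derivation G [NT (start G)] rs (map T (x @ y))}.
       ennreal (derivation_prob G rs))"
proof -
  let ?B = "\<lambda>y. {rs. leftmost_derivation G [NT (start G)] rs (map T (x @ y))}"
  have "y \<in> lists (terminals G)" if "rs \<in> ?B y" for y rs
    using leftmost_derivation_terminals[OF assms, of "[NT (start G)]" rs "map T (x @ y)"] that assms
    by (auto simp: is_scfg_def)
  then have "{rs. \<exists>y. leftmost_derivation G [NT (start G)] rs (map T (x @ y))} =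
      (\<Union>y\<in>lists (terminals G). ?B y)"
    by blast
  moreover have "disjoint_family_on ?B (lists (terminals G))"
    unfolding disjoint_family_on_def
    by (auto simp del: map_append dest: leftmost_derivation_functional)
  ultimately show ?thesis
    by (simp add: prefix_prob_def string_prob_def infsum_UN_ennreal)
qed

text \<open>For a fixed first half \<open>p\<close>, the second halves contribute the termination
  probability of \<open>sentential_form p\<close>, which is 1.\<close>

lemma prefix_prob_scanning_paths:
  assumes G: "is_scfg G" "proper G" "consistent G" "no_useless_nonterminals G" and x: "x \<noteq> []"
  shows "prefix_prob G x = (\<Sum>\<^sub>\<infinity>p\<in>scanning_paths G x. ennreal (path_prob G p))"
proof -
  have "prefix_prob G x = (\<Sum>\<^sub>\<infinity>(p, rs)\<in>(SIGMA p:scanning_paths G x. terminating G (sentential_form p)).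
      ennreal (derivation_prob G (expansions G p @ rs)))"
    unfolding prefix_prob_eq_infsum[OF G(1)]
    by (subst infsum_reindex_bij_betw[OF bij_betw_scanning_paths[OF x], symmetric])
      (simp add: split_def)
  also have "\<dots> = (\<Sum>\<^sub>\<infinity>p\<in>scanning_paths G x. \<Sum>\<^sub>\<infinity>rs\<in>terminating G (sentential_form p).
      ennreal (derivation_prob G (expansions G p @ rs)))"
    by (simp add: infsum_Sigma_ennreal)
  also have "\<dots> = (\<Sum>\<^sub>\<infinity>p\<in>scanning_paths G x. ennreal (path_prob G p))"
  proof (rule infsum_cong)
    fix p assume "p \<in> scanning_paths G x"
    then have deriv: "leftmost_derivation G [NT (start G)] (expansions G p) (sentential_form p)"
      using sentential_form_path[of G p] by (simp add: scanning_paths_def)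
    have "set (sentential_form p) \<subseteq> NT ` nonterms G \<union> T ` terminals G"
      using leftmost_derivation_terminals[OF G(1) deriv] G(1) by (simp add: is_scfg_def)
    then have "termination_prob G (sentential_form p) = 1" by (rule termination_prob_eq_1[OF G])
    moreover note ennreal_derivation_prob_append[OF G(1) leftmost_derivation_prods[OF deriv]]
    ultimately show "(\<Sum>\<^sub>\<infinity>rs\<in>terminating G (sentential_form p).
        ennreal (derivation_prob G (expansions G p @ rs))) = ennreal (path_prob G p)"
      by (simp add: infsum_cmult_ennreal path_prob_eq flip: termination_prob_def)
  qed
  finally show ?thesis .
qed

lemma scanning_paths_eq_UN_forward_paths:
  assumes "no_null_productions G"
  shows "scanning_paths G x =
    (\<Union>s\<in>{s \<in> chart G x. scanned_state s \<and> pos s = length x}. forward_paths G x s)"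
proof (intro equalityI subsetI)
  fix p assume "p \<in> scanning_paths G x"
  then have p: "path G p" "fst (hd p) = initial_state G" "scanned_state (fst (last p))"
    "generated_string p = x"
    by (simp_all add: scanning_paths_def)
  have "fst ` set p \<subseteq> chart G x"
    using p assms chart.init[of G x] by (intro path_in_chart) (auto simp: initial_state_def)
  then have "fst (last p) \<in> chart G x" using path_not_Nil[OF p(1)] by auto
  moreover have "pos (fst (last p)) = length x"
    using path_pos[OF p(1)] p by (simp add: initial_state_def)
  ultimately show "p \<in> (\<Union>s\<in>{s \<in> chart G x. scanned_state s \<and> pos s = length x}. forward_paths G x s)"
    using p by (auto simp: forward_paths_def path_length_eq substring_def)
qed (auto simp: forward_paths_def scanning_paths_def substring_def)

lemma prefix_prob_forward_prob:
  assumes G: "is_scfg G" "proper G" "consistent G" "no_useless_nonterminals G"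
    "no_null_productions G" and x: "x \<noteq> []"
  shows "prefix_prob G x =
    (\<Sum>s | s \<in> chart G x \<and> scanned_state s \<and> pos s = length x. forward_prob G x s)"
  unfolding prefix_prob_scanning_paths[OF G(1-4) x] scanning_paths_eq_UN_forward_paths[OF G(5)]
    forward_prob_def
  using finite_chart[OF G(1)]
  by (intro infsum_finite_UN_ennreal) (auto simp: disjoint_family_on_def forward_paths_def)

theorem lemma3:
  fixes G :: "('n, 't) scfg" and x :: "'t list"
  assumes "is_scfg G"
    and "proper G"
    and "consistent G"
    and "no_useless_nonterminals G"
    and "no_null_productions G"
    and "x \<in> lists (terminals G)"
    and "length x \<ge> 1"
  shows
    "(\<forall>k i X. k < i \<and> i \<le> length x \<and> X \<in> nonterms G \<and>
        (\<exists>\<nu> rs. leftmost_derivation G [NT (start G)] rs (map T (substring x 0 k) @ NT X # \<nu>)) \<longrightarrow>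
        string_prob G X (substring x k i) =
          (\<Sum>s | s \<in> chart G x \<and> complete_state s \<and> pos s = i \<and> lhs s = Some X \<and> origin s = k.
             inner_prob G x s)) \<and>
     (string_prob G (start G) x = inner_prob G x (final_state G (length x)) \<and>
      inner_prob G x (final_state G (length x)) = forward_prob G x (final_state G (length x))) \<and>
     prefix_prob G x =
       (\<Sum>s | s \<in> chart G x \<and> scanned_state s \<and> pos s = length x. forward_prob G x s)"
proof (intro conjI)
  show "\<forall>k i X. k < i \<and> i \<le> length x \<and> X \<in> nonterms G \<and>
        (\<exists>\<nu> rs. leftmost_derivation G [NT (start G)] rs (map T (substring x 0 k) @ NT X # \<nu>)) \<longrightarrow>
        string_prob G X (substring x k i) =
          (\<Sum>s | s \<in> chart G x \<and> complete_state s \<and> pos s = i \<and> lhs s = Some X \<and> origin s = k.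
             inner_prob G x s)"
    using string_prob_inner_prob[OF assms(1,5)] by blast
  show "string_prob G (start G) x = inner_prob G x (final_state G (length x))"
    by (simp add: inner_prob_def inner_paths_final_state string_prob_initial_paths)
  show "inner_prob G x (final_state G (length x)) = forward_prob G x (final_state G (length x))"
    by (simp add: inner_prob_def forward_prob_def forward_paths_final_state)
  have "x \<noteq> []" using assms(7) by auto
  with assms(1-5) show "prefix_prob G x =
       (\<Sum>s | s \<in> chart G x \<and> scanned_state s \<and> pos s = length x. forward_prob G x s)"
    by (rule prefix_prob_forward_prob)
qed

end
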